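(* Let $F$ be a finite field of characteristic $3$ containing $q=3^k$ elements, let $n\ge 1$ be an integer, and let $G=C_n\times D_{12}$. Then $$U(FG)\cong (C_3^{6nk}\rtimes C_3^{2nk})\rtimes U\big(F(C_n\times C_2^2)\big).$$
   Context: $C_m$ denotes the cyclic group of order $m$, and $C_m^j$ the direct product of $j$ copies of $C_m$. $D_{12}$ is the dihedral group of order 12, $D_{12}=\langle x,y\mid x^6=y^2=1,\ yx=x^5y\rangle$. For a finite group $H$, $FH$ is the group algebra of $H$ over $F$ and $U(FH)$ is its group of units. The symbol $A\rtimes B$ denotes a semidirect product with normal factor $A$ for some action of $B$ on $A$. *)

theory Defs
  imports "HOL-Algebra.Algebra"
begin

definition cyclic_power :: "nat \<Rightarrow> nat \<Rightarrow> (nat \<Rightarrow> int) monoid"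
  where "cyclic_power m j = product_group {..<j} (\<lambda>_. integer_mod_group m)"

text \<open>
  The dihedral group of order \<open>2 * m\<close> (\<open>m > 0\<close>). The pair \<open>(i, s)\<close> stands for \<open>x^i * y^s\<close>, where
  \<open>x\<close> is the rotation of order \<open>m\<close>, \<open>y\<close> is a reflection, and \<open>s\<close> tells whether \<open>y\<close> occurs;
  the multiplication comes from \<open>y * x^j = x^(-j) * y\<close>.
\<close>
definition dihedral_group :: "nat \<Rightarrow> (int \<times> bool) monoid"
  where "dihedral_group m =
    \<lparr>carrier = {0..<int m} \<times> UNIV,
     monoid.mult = (\<lambda>(i, s) (j, t). ((if s then i - j else i + j) mod int m, s \<noteq> t)),
     monoid.one = (0, False)\<rparr>"

text \<open>
  The external semidirect product with normal factor \<open>A\<close>; an action of \<open>B\<close> on \<open>A\<close> is an element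
  \<open>\<phi>\<close> of \<open>hom B (AutoGroup A)\<close>.
\<close>
definition semidirect_product ::
  "('a, 'm) monoid_scheme \<Rightarrow> ('b, 'n) monoid_scheme \<Rightarrow> ('b \<Rightarrow> 'a \<Rightarrow> 'a) \<Rightarrow> ('a \<times> 'b) monoid"
  where "semidirect_product A B \<phi> =
    \<lparr>carrier = carrier A \<times> carrier B,
     monoid.mult = (\<lambda>(a, b) (a', b'). (a \<otimes>\<^bsub>A\<^esub> \<phi> b a', b \<otimes>\<^bsub>B\<^esub> b')),
     monoid.one = (\<one>\<^bsub>A\<^esub>, \<one>\<^bsub>B\<^esub>)\<rparr>"

text \<open>
  The group algebra of a finite group \<open>H\<close> over \<open>R\<close> as a ring: the function \<open>f\<close> stands for the
  formal sum of the \<open>f h\<close> times \<open>h\<close> over all \<open>h\<close> in \<open>H\<close>, so that the product is convolution.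
  Functions are extensional (\<open>undefined\<close> outside \<open>carrier H\<close>). There is no finite-support
  condition, hence the definition is meaningful for finite \<open>H\<close> only.
\<close>
definition group_algebra ::
  "('r, 'm) ring_scheme \<Rightarrow> ('g, 'n) monoid_scheme \<Rightarrow> ('g \<Rightarrow> 'r) ring"
  where "group_algebra R H =
    \<lparr>carrier = carrier H \<rightarrow>\<^sub>E carrier R,
     monoid.mult = (\<lambda>f f'. \<lambda>g\<in>carrier H.
        \<Oplus>\<^bsub>R\<^esub>h\<in>carrier H. f h \<otimes>\<^bsub>R\<^esub> f' (inv\<^bsub>H\<^esub> h \<otimes>\<^bsub>H\<^esub> g)),
     monoid.one = (\<lambda>g\<in>carrier H. if g = \<one>\<^bsub>H\<^esub> then \<one>\<^bsub>R\<^esub> else \<zero>\<^bsub>R\<^esub>),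
     ring.zero = (\<lambda>g\<in>carrier H. \<zero>\<^bsub>R\<^esub>),
     ring.add = (\<lambda>f f'. \<lambda>g\<in>carrier H. f g \<oplus>\<^bsub>R\<^esub> f' g)\<rparr>"

text \<open>The additive order of \<open>\<one>\<close>; as \<^const>\<open>group.ord\<close>, it is \<open>0\<close> if that order is infinite.\<close>
definition ring_char :: "('r, 'm) ring_scheme \<Rightarrow> nat"
  where "ring_char R = group.ord (add_monoid R) \<one>\<^bsub>R\<^esub>"

lemma dihedral_group_is_group:
  assumes "m > 0"
  shows "group (dihedral_group m)"
proof (rule groupI)
  fix p q r
  assume "p \<in> carrier (dihedral_group m)" "q \<in> carrier (dihedral_group m)"
    "r \<in> carrier (dihedral_group m)"
  show "p \<otimes>\<^bsub>dihedral_group m\<^esub> q \<otimes>\<^bsub>dihedral_group m\<^esub> r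
      = p \<otimes>\<^bsub>dihedral_group m\<^esub> (q \<otimes>\<^bsub>dihedral_group m\<^esub> r)"
    by (cases p; cases q; cases r)
      (auto simp: dihedral_group_def mod_simps algebra_simps)
next
  fix p
  assume p: "p \<in> carrier (dihedral_group m)"
  obtain i s where [simp]: "p = (i, s)" by force
  show "\<exists>q\<in>carrier (dihedral_group m). q \<otimes>\<^bsub>dihedral_group m\<^esub> p = \<one>\<^bsub>dihedral_group m\<^esub>"
    using p assms
    by (intro bexI[of _ "(if s then i else (- i) mod int m, s)"])
      (auto simp: dihedral_group_def mod_simps)
qed (use assms in \<open>auto simp: dihedral_group_def\<close>)

lemma order_dihedral_group: "order (dihedral_group m) = 2 * m"
  by (simp add: order_def dihedral_group_def card_cartesian_product)

lemma dihedral_group_6_relations: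
  defines "D \<equiv> dihedral_group 6" and "x \<equiv> (1, False)" and "y \<equiv> (0, True)"
  shows "x \<in> carrier D" "y \<in> carrier D"
    and "x [^]\<^bsub>D\<^esub> (6::nat) = \<one>\<^bsub>D\<^esub>" "y [^]\<^bsub>D\<^esub> (2::nat) = \<one>\<^bsub>D\<^esub>"
    and "y \<otimes>\<^bsub>D\<^esub> x = x [^]\<^bsub>D\<^esub> (5::nat) \<otimes>\<^bsub>D\<^esub> y"
  by (simp_all add: D_def x_def y_def dihedral_group_def nat_pow_def numeral_eq_Suc)

text \<open>
  Together with the relations above, the next two lemmas say that \<open>dihedral_group 6\<close> has the
  presentation \<open>\<langle>x, y | x^6 = y^2 = 1, y * x = x^5 * y\<rangle>\<close>.
\<close>
lemma dihedral_group_6_generate: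
  "generate (dihedral_group 6) {(1, False), (0, True)} = carrier (dihedral_group 6)"
proof -
  define D where "D = dihedral_group 6"
  define S where "S = generate D {(1, False), (0, True)}"
  interpret group D unfolding D_def by (rule dihedral_group_is_group) simp
  have x: "(1, False) \<in> S" and y: "(0, True) \<in> S"
    unfolding S_def by (auto intro: generate.incl)
  have rot: "(int i mod 6, False) \<in> S" for i
  proof (induction i)
    case 0
    show ?case using generate.one[of D] by (simp add: S_def D_def dihedral_group_def)
  next
    case (Suc i)
    have "(int i mod 6, False) \<otimes>\<^bsub>D\<^esub> (1, False) \<in> S"
      using Suc x unfolding S_def by (rule generate.eng)
    then show ?case by (simp add: D_def dihedral_group_def mod_simps add.commute)
  qed
  have refl: "(int i mod 6, True) \<in> S" for i
  proof -
    have "(int i mod 6, False) \<otimes>\<^bsub>D\<^esub> (0, True) \<in> S"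
      using rot y unfolding S_def by (rule generate.eng)
    then show ?thesis by (simp add: D_def dihedral_group_def)
  qed
  have "p \<in> S" if "p \<in> carrier D" for p
  proof -
    obtain i s where p: "p = (i, s)" by force
    with that have i: "0 \<le> i" "i < 6" by (auto simp: D_def dihedral_group_def)
    then show ?thesis using rot[of "nat i"] refl[of "nat i"] p by (cases s) auto
  qed
  moreover have "S \<subseteq> carrier D"
    unfolding S_def by (rule generate_incl) (auto simp: D_def dihedral_group_def)
  ultimately show ?thesis by (auto simp: S_def D_def)
qed

lemma dihedral_group_6_universal:
  assumes "group H" and a: "a \<in> carrier H" and b: "b \<in> carrier H"
    and "a [^]\<^bsub>H\<^esub> (6::nat) = \<one>\<^bsub>H\<^esub>" and "b [^]\<^bsub>H\<^esub> (2::nat) = \<one>\<^bsub>H\<^esub>"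
    and rel: "b \<otimes>\<^bsub>H\<^esub> a = a [^]\<^bsub>H\<^esub> (5::nat) \<otimes>\<^bsub>H\<^esub> b"
  shows "\<exists>f\<in>hom (dihedral_group 6) H. f (1, False) = a \<and> f (0, True) = b"
proof -
  interpret group H by fact
  note [simp] = a b
  have a6: "a [^]\<^bsub>H\<^esub> (6::int) = \<one>\<^bsub>H\<^esub>"
    using assms(4) int_pow_int[of H a 6] by simp
  have bb: "b \<otimes>\<^bsub>H\<^esub> b = \<one>\<^bsub>H\<^esub>"
    using assms(5) by (simp add: numeral_2_eq_2)
  have md: "a [^]\<^bsub>H\<^esub> (i mod 6) = a [^]\<^bsub>H\<^esub> (i::int)" for i
  proof -
    have "a [^]\<^bsub>H\<^esub> i = a [^]\<^bsub>H\<^esub> (6 * (i div 6) + i mod 6)" by simp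
    also have "\<dots> = (a [^]\<^bsub>H\<^esub> (6::int)) [^]\<^bsub>H\<^esub> (i div 6) \<otimes>\<^bsub>H\<^esub> a [^]\<^bsub>H\<^esub> (i mod 6)"
      by (simp only: int_pow_mult int_pow_pow a)
    finally show ?thesis by (simp add: a6)
  qed
  have "a [^]\<^bsub>H\<^esub> (5::nat) = a [^]\<^bsub>H\<^esub> (-1::int)"
    using md[of "-1"] int_pow_int[of H a 5] by simp
  then have rel': "b \<otimes>\<^bsub>H\<^esub> a = inv\<^bsub>H\<^esub> a \<otimes>\<^bsub>H\<^esub> b"
    using rel by (simp add: int_pow_neg)
  have flip_nat: "b \<otimes>\<^bsub>H\<^esub> a [^]\<^bsub>H\<^esub> (j::nat) = inv\<^bsub>H\<^esub> a [^]\<^bsub>H\<^esub> j \<otimes>\<^bsub>H\<^esub> b" for j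
  proof (induction j)
    case (Suc j)
    have "b \<otimes>\<^bsub>H\<^esub> a [^]\<^bsub>H\<^esub> Suc j = (b \<otimes>\<^bsub>H\<^esub> a [^]\<^bsub>H\<^esub> j) \<otimes>\<^bsub>H\<^esub> a" by (simp add: m_assoc)
    also have "\<dots> = inv\<^bsub>H\<^esub> a [^]\<^bsub>H\<^esub> j \<otimes>\<^bsub>H\<^esub> (b \<otimes>\<^bsub>H\<^esub> a)" by (simp add: Suc m_assoc)
    also have "\<dots> = inv\<^bsub>H\<^esub> a [^]\<^bsub>H\<^esub> Suc j \<otimes>\<^bsub>H\<^esub> b" by (simp add: rel' m_assoc)
    finally show ?case .
  qed simp
  have flip: "b \<otimes>\<^bsub>H\<^esub> a [^]\<^bsub>H\<^esub> j = a [^]\<^bsub>H\<^esub> (- j) \<otimes>\<^bsub>H\<^esub> b" for j :: int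
  proof -
    have "b \<otimes>\<^bsub>H\<^esub> a [^]\<^bsub>H\<^esub> (j mod 6) = a [^]\<^bsub>H\<^esub> (- (j mod 6)) \<otimes>\<^bsub>H\<^esub> b"
      using flip_nat[of "nat (j mod 6)"]
        int_pow_int[of H a "nat (j mod 6)", symmetric]
      by (simp add: int_pow_neg int_pow_inv nat_pow_inv)
    moreover have "a [^]\<^bsub>H\<^esub> (- (j mod 6)) = a [^]\<^bsub>H\<^esub> (- j)"
      by (metis md mod_minus_eq)
    ultimately show ?thesis by (simp add: md)
  qed
  have flip2: "b \<otimes>\<^bsub>H\<^esub> (a [^]\<^bsub>H\<^esub> j \<otimes>\<^bsub>H\<^esub> c) = a [^]\<^bsub>H\<^esub> (- j) \<otimes>\<^bsub>H\<^esub> (b \<otimes>\<^bsub>H\<^esub> c)"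
    if "c \<in> carrier H" for j :: int and c
    using flip[of j] that by (simp add: m_assoc[symmetric])
  have mul: "a [^]\<^bsub>H\<^esub> i \<otimes>\<^bsub>H\<^esub> (a [^]\<^bsub>H\<^esub> j \<otimes>\<^bsub>H\<^esub> c) = a [^]\<^bsub>H\<^esub> (i + j) \<otimes>\<^bsub>H\<^esub> c"
    if "c \<in> carrier H" for i j :: int and c
    using that by (simp add: int_pow_mult m_assoc)
  let ?f = "\<lambda>(i::int, s). a [^]\<^bsub>H\<^esub> i \<otimes>\<^bsub>H\<^esub> (if s then b else \<one>\<^bsub>H\<^esub>)"
  have "?f \<in> hom (dihedral_group 6) H"
  proof (rule homI)
    fix p q assume "p \<in> carrier (dihedral_group 6)" "q \<in> carrier (dihedral_group 6)"
    obtain i s j t where [simp]: "p = (i, s)" "q = (j, t)" by (metis surj_pair)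
    show "?f (p \<otimes>\<^bsub>dihedral_group 6\<^esub> q) = ?f p \<otimes>\<^bsub>H\<^esub> ?f q"
      using mul[of \<open>\<one>\<^bsub>H\<^esub>\<close> i j] mul[of b i j] mul[of b i "- j"] mul[of "\<one>\<^bsub>H\<^esub>" i "- j"]
      by (auto simp: dihedral_group_def md m_assoc flip flip2 bb)
  qed auto
  then show ?thesis by (intro bexI[of _ ?f]) auto
qed

lemma semidirect_product_is_group:
  assumes "group A" "group B" and \<phi>: "\<phi> \<in> hom B (AutoGroup A)"
  shows "group (semidirect_product A B \<phi>)"
proof -
  interpret A: group A by fact
  interpret B: group B by fact
  have au: "\<phi> b \<in> auto A" if "b \<in> carrier B" for b
    using hom_carrier[OF \<phi>] that by (auto simp: AutoGroup_def)
  have cl: "\<phi> b a \<in> carrier A" if "b \<in> carrier B" "a \<in> carrier A" for a b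
    using au[OF that(1)] that(2) by (auto simp: auto_def hom_def)
  have mu: "\<phi> b (a \<otimes>\<^bsub>A\<^esub> a') = \<phi> b a \<otimes>\<^bsub>A\<^esub> \<phi> b a'"
    if "b \<in> carrier B" "a \<in> carrier A" "a' \<in> carrier A" for a a' b
    using au[OF that(1)] that(2,3) by (auto simp: auto_def hom_def)
  have co: "\<phi> (b \<otimes>\<^bsub>B\<^esub> b') a = \<phi> b (\<phi> b' a)"
    if "b \<in> carrier B" "b' \<in> carrier B" "a \<in> carrier A" for a b b'
    using hom_mult[OF \<phi> that(1,2)] au[OF that(1)] au[OF that(2)] that(3)
    by (simp add: AutoGroup_def BijGroup_def auto_def compose_def)
  have on: "\<phi> \<one>\<^bsub>B\<^esub> a = a" if "a \<in> carrier A" for a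
    using hom_one[OF \<phi> B.is_group A.AutoGroup] that
    by (simp add: AutoGroup_def BijGroup_def)
  show ?thesis
  proof (rule groupI)
    fix p q r
    assume "p \<in> carrier (semidirect_product A B \<phi>)" "q \<in> carrier (semidirect_product A B \<phi>)"
      "r \<in> carrier (semidirect_product A B \<phi>)"
    then show "p \<otimes>\<^bsub>semidirect_product A B \<phi>\<^esub> q \<otimes>\<^bsub>semidirect_product A B \<phi>\<^esub> r
        = p \<otimes>\<^bsub>semidirect_product A B \<phi>\<^esub> (q \<otimes>\<^bsub>semidirect_product A B \<phi>\<^esub> r)"
      by (auto simp: semidirect_product_def A.m_assoc B.m_assoc mu co cl)
  next
    fix p
    assume p: "p \<in> carrier (semidirect_product A B \<phi>)"
    obtain a b where [simp]: "p = (a, b)" by force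
    from p have [simp]: "a \<in> carrier A" "b \<in> carrier B"
      by (auto simp: semidirect_product_def)
    let ?q = "(inv\<^bsub>A\<^esub> (\<phi> (inv\<^bsub>B\<^esub> b) a), inv\<^bsub>B\<^esub> b)"
    have "?q \<in> carrier (semidirect_product A B \<phi>)"
      and "?q \<otimes>\<^bsub>semidirect_product A B \<phi>\<^esub> p = \<one>\<^bsub>semidirect_product A B \<phi>\<^esub>"
      by (simp_all add: semidirect_product_def cl)
    then show "\<exists>q\<in>carrier (semidirect_product A B \<phi>).
        q \<otimes>\<^bsub>semidirect_product A B \<phi>\<^esub> p = \<one>\<^bsub>semidirect_product A B \<phi>\<^esub>" by blast
  qed (auto simp: semidirect_product_def cl on)
qed

lemma group_algebra_is_ring:
  assumes "ring R" "group H" and fin: "finite (carrier H)"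
  shows "ring (group_algebra R H)"
proof -
  interpret R: ring R by fact
  interpret H: group H by fact
  let ?A = "group_algebra R H"
  have cl: "f h \<in> carrier R" if "f \<in> carrier ?A" "h \<in> carrier H" for f h
    using that by (auto simp: group_algebra_def)
  have sw: "(\<Oplus>\<^bsub>R\<^esub>h\<in>S. \<Oplus>\<^bsub>R\<^esub>u\<in>T. k h u) = (\<Oplus>\<^bsub>R\<^esub>u\<in>T. \<Oplus>\<^bsub>R\<^esub>h\<in>S. k h u)"
    if "finite S" "\<And>h u. h \<in> S \<Longrightarrow> u \<in> T \<Longrightarrow> k h u \<in> carrier R" for k S T
    using that
  proof (induction S rule: finite_induct)
    case empty
    show ?case by simp
  next
    case (insert x S)
    have "(\<Oplus>\<^bsub>R\<^esub>u\<in>T. \<Oplus>\<^bsub>R\<^esub>h\<in>insert x S. k h u) = (\<Oplus>\<^bsub>R\<^esub>u\<in>T. k x u \<oplus>\<^bsub>R\<^esub> (\<Oplus>\<^bsub>R\<^esub>h\<in>S. k h u))"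
      using insert by (intro R.finsum_cong') (auto intro!: R.finsum_insert R.add.m_closed R.finsum_closed)
    also have "\<dots> = (\<Oplus>\<^bsub>R\<^esub>u\<in>T. k x u) \<oplus>\<^bsub>R\<^esub> (\<Oplus>\<^bsub>R\<^esub>u\<in>T. \<Oplus>\<^bsub>R\<^esub>h\<in>S. k h u)"
      using insert by (intro R.finsum_addf) (auto intro!: R.finsum_closed)
    also have "\<dots> = (\<Oplus>\<^bsub>R\<^esub>h\<in>insert x S. \<Oplus>\<^bsub>R\<^esub>u\<in>T. k h u)"
      using insert by (subst R.finsum_insert) (auto intro!: R.finsum_closed)
    finally show ?case by simp
  qed
  have mult_in: "f \<otimes>\<^bsub>?A\<^esub> f' \<in> carrier ?A" if "f \<in> carrier ?A" "f' \<in> carrier ?A" for f f'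
    using that by (auto simp: group_algebra_def intro!: R.finsum_closed R.m_closed)
  have mult_ap: "(f \<otimes>\<^bsub>?A\<^esub> f') g = (\<Oplus>\<^bsub>R\<^esub>h\<in>carrier H. f h \<otimes>\<^bsub>R\<^esub> f' (inv\<^bsub>H\<^esub> h \<otimes>\<^bsub>H\<^esub> g))"
    if "g \<in> carrier H" for f f' g
    using that by (simp add: group_algebra_def)
  have eq: "f = f'" if "f \<in> carrier ?A" "f' \<in> carrier ?A" "\<And>g. g \<in> carrier H \<Longrightarrow> f g = f' g" for f f'
    using that PiE_ext[of f "carrier H" "\<lambda>_. carrier R" f'] by (simp add: group_algebra_def)
  show ?thesis
  proof (intro ringI abelian_groupI monoidI)
    fix f assume f: "f \<in> carrier ?A"
    show "\<exists>f'\<in>carrier ?A. f' \<oplus>\<^bsub>?A\<^esub> f = \<zero>\<^bsub>?A\<^esub>"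
      using f by (intro bexI[of _ "\<lambda>g\<in>carrier H. \<ominus>\<^bsub>R\<^esub> f g"])
        (auto simp: group_algebra_def intro!: ext R.l_neg)
  next
    fix f assume f: "f \<in> carrier ?A"
    have one_in: "\<one>\<^bsub>?A\<^esub> \<in> carrier ?A" by (auto simp: group_algebra_def)
    have one_ap: "\<one>\<^bsub>?A\<^esub> g = (if g = \<one>\<^bsub>H\<^esub> then \<one>\<^bsub>R\<^esub> else \<zero>\<^bsub>R\<^esub>)" if "g \<in> carrier H" for g
      using that by (simp add: group_algebra_def)
    show "\<one>\<^bsub>?A\<^esub> \<otimes>\<^bsub>?A\<^esub> f = f"
    proof (rule eq)
      fix g assume g: "g \<in> carrier H"
      have "(\<one>\<^bsub>?A\<^esub> \<otimes>\<^bsub>?A\<^esub> f) g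
          = (\<Oplus>\<^bsub>R\<^esub>h\<in>carrier H. if \<one>\<^bsub>H\<^esub> = h then f (inv\<^bsub>H\<^esub> h \<otimes>\<^bsub>H\<^esub> g) else \<zero>\<^bsub>R\<^esub>)"
        unfolding mult_ap[OF g] using f g
        by (intro R.finsum_cong') (auto simp: cl one_ap)
      also have "\<dots> = f (inv\<^bsub>H\<^esub> \<one>\<^bsub>H\<^esub> \<otimes>\<^bsub>H\<^esub> g)"
        using f g by (intro R.finsum_singleton) (auto simp: fin cl)
      finally show "(\<one>\<^bsub>?A\<^esub> \<otimes>\<^bsub>?A\<^esub> f) g = f g" using g by simp
    qed (simp_all add: f one_in mult_in)
    show "f \<otimes>\<^bsub>?A\<^esub> \<one>\<^bsub>?A\<^esub> = f"
    proof (rule eq)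
      fix g assume g: "g \<in> carrier H"
      have iff: "inv\<^bsub>H\<^esub> h \<otimes>\<^bsub>H\<^esub> g = \<one>\<^bsub>H\<^esub> \<longleftrightarrow> g = h" if "h \<in> carrier H" for h
        using that g by (metis H.inv_closed H.inv_equality H.inv_inv H.l_inv)
      have "(f \<otimes>\<^bsub>?A\<^esub> \<one>\<^bsub>?A\<^esub>) g = (\<Oplus>\<^bsub>R\<^esub>h\<in>carrier H. if g = h then f h else \<zero>\<^bsub>R\<^esub>)"
        unfolding mult_ap[OF g] using f g
        by (intro R.finsum_cong') (auto simp: cl one_ap iff)
      also have "\<dots> = f g"
        using f g by (intro R.finsum_singleton) (auto simp: fin cl)
      finally show "(f \<otimes>\<^bsub>?A\<^esub> \<one>\<^bsub>?A\<^esub>) g = f g" .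
    qed (simp_all add: f one_in mult_in)
  next
    fix f f' f'' assume f: "f \<in> carrier ?A" "f' \<in> carrier ?A" "f'' \<in> carrier ?A"
    show "f \<otimes>\<^bsub>?A\<^esub> f' \<otimes>\<^bsub>?A\<^esub> f'' = f \<otimes>\<^bsub>?A\<^esub> (f' \<otimes>\<^bsub>?A\<^esub> f'')"
    proof (rule eq)
      fix g assume g: "g \<in> carrier H"
      have "(f \<otimes>\<^bsub>?A\<^esub> f' \<otimes>\<^bsub>?A\<^esub> f'') g = (\<Oplus>\<^bsub>R\<^esub>h\<in>carrier H. \<Oplus>\<^bsub>R\<^esub>u\<in>carrier H.
          f u \<otimes>\<^bsub>R\<^esub> f' (inv\<^bsub>H\<^esub> u \<otimes>\<^bsub>H\<^esub> h) \<otimes>\<^bsub>R\<^esub> f'' (inv\<^bsub>H\<^esub> h \<otimes>\<^bsub>H\<^esub> g))"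
        unfolding mult_ap[OF g] using f g
        by (intro R.finsum_cong' refl)
          (auto simp: mult_ap cl fin intro!: R.finsum_ldistr R.finsum_closed R.m_closed)
      also have "\<dots> = (\<Oplus>\<^bsub>R\<^esub>u\<in>carrier H. \<Oplus>\<^bsub>R\<^esub>h\<in>carrier H.
          f u \<otimes>\<^bsub>R\<^esub> f' (inv\<^bsub>H\<^esub> u \<otimes>\<^bsub>H\<^esub> h) \<otimes>\<^bsub>R\<^esub> f'' (inv\<^bsub>H\<^esub> h \<otimes>\<^bsub>H\<^esub> g))"
        using f g by (intro sw) (auto simp: fin cl)
      also have "\<dots> = (\<Oplus>\<^bsub>R\<^esub>u\<in>carrier H. f u \<otimes>\<^bsub>R\<^esub> (f' \<otimes>\<^bsub>?A\<^esub> f'') (inv\<^bsub>H\<^esub> u \<otimes>\<^bsub>H\<^esub> g))"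
      proof (intro R.finsum_cong' refl)
        fix u assume u: "u \<in> carrier H"
        have bij: "(\<lambda>v. u \<otimes>\<^bsub>H\<^esub> v) ` carrier H = carrier H"
          using H.surj_const_mult[OF u] .
        have "(\<Oplus>\<^bsub>R\<^esub>h\<in>carrier H. f u \<otimes>\<^bsub>R\<^esub> f' (inv\<^bsub>H\<^esub> u \<otimes>\<^bsub>H\<^esub> h) \<otimes>\<^bsub>R\<^esub> f'' (inv\<^bsub>H\<^esub> h \<otimes>\<^bsub>H\<^esub> g))
          = (\<Oplus>\<^bsub>R\<^esub>h\<in>(\<lambda>v. u \<otimes>\<^bsub>H\<^esub> v) ` carrier H. f u \<otimes>\<^bsub>R\<^esub> f' (inv\<^bsub>H\<^esub> u \<otimes>\<^bsub>H\<^esub> h) \<otimes>\<^bsub>R\<^esub> f'' (inv\<^bsub>H\<^esub> h \<otimes>\<^bsub>H\<^esub> g))"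
          by (simp add: bij)
        also have "\<dots> = (\<Oplus>\<^bsub>R\<^esub>v\<in>carrier H. f u \<otimes>\<^bsub>R\<^esub> f' (inv\<^bsub>H\<^esub> u \<otimes>\<^bsub>H\<^esub> (u \<otimes>\<^bsub>H\<^esub> v)) \<otimes>\<^bsub>R\<^esub> f'' (inv\<^bsub>H\<^esub> (u \<otimes>\<^bsub>H\<^esub> v) \<otimes>\<^bsub>H\<^esub> g))"
          using f g u by (intro R.finsum_reindex) (auto simp: cl H.inj_on_cmult)
        also have "\<dots> = (\<Oplus>\<^bsub>R\<^esub>v\<in>carrier H. f u \<otimes>\<^bsub>R\<^esub> (f' v \<otimes>\<^bsub>R\<^esub> f'' (inv\<^bsub>H\<^esub> v \<otimes>\<^bsub>H\<^esub> (inv\<^bsub>H\<^esub> u \<otimes>\<^bsub>H\<^esub> g))))"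
          using f g u by (intro R.finsum_cong')
            (auto simp: cl H.m_assoc[symmetric] H.inv_mult_group R.m_assoc)
        also have "\<dots> = f u \<otimes>\<^bsub>R\<^esub> (f' \<otimes>\<^bsub>?A\<^esub> f'') (inv\<^bsub>H\<^esub> u \<otimes>\<^bsub>H\<^esub> g)"
          using f g u by (subst mult_ap) (auto simp: cl fin intro!: R.finsum_rdistr[symmetric])
        finally show "(\<Oplus>\<^bsub>R\<^esub>h\<in>carrier H. f u \<otimes>\<^bsub>R\<^esub> f' (inv\<^bsub>H\<^esub> u \<otimes>\<^bsub>H\<^esub> h) \<otimes>\<^bsub>R\<^esub> f'' (inv\<^bsub>H\<^esub> h \<otimes>\<^bsub>H\<^esub> g))
          = f u \<otimes>\<^bsub>R\<^esub> (f' \<otimes>\<^bsub>?A\<^esub> f'') (inv\<^bsub>H\<^esub> u \<otimes>\<^bsub>H\<^esub> g)" .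
      qed (use f g in \<open>auto simp: cl mult_in\<close>)
      finally show "(f \<otimes>\<^bsub>?A\<^esub> f' \<otimes>\<^bsub>?A\<^esub> f'') g = (f \<otimes>\<^bsub>?A\<^esub> (f' \<otimes>\<^bsub>?A\<^esub> f'')) g"
        using g by (simp add: mult_ap)
    qed (simp_all add: f mult_in)
    have add_in: "p \<oplus>\<^bsub>?A\<^esub> q \<in> carrier ?A" if "p \<in> carrier ?A" "q \<in> carrier ?A" for p q
      using that by (auto simp: group_algebra_def)
    have add_ap: "(p \<oplus>\<^bsub>?A\<^esub> q) g = p g \<oplus>\<^bsub>R\<^esub> q g" if "g \<in> carrier H" for p q g
      using that by (simp add: group_algebra_def)
    show "(f \<oplus>\<^bsub>?A\<^esub> f') \<otimes>\<^bsub>?A\<^esub> f'' = f \<otimes>\<^bsub>?A\<^esub> f'' \<oplus>\<^bsub>?A\<^esub> f' \<otimes>\<^bsub>?A\<^esub> f''"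
    proof (rule eq)
      fix g assume g: "g \<in> carrier H"
      have "((f \<oplus>\<^bsub>?A\<^esub> f') \<otimes>\<^bsub>?A\<^esub> f'') g = (\<Oplus>\<^bsub>R\<^esub>h\<in>carrier H.
          f h \<otimes>\<^bsub>R\<^esub> f'' (inv\<^bsub>H\<^esub> h \<otimes>\<^bsub>H\<^esub> g) \<oplus>\<^bsub>R\<^esub> f' h \<otimes>\<^bsub>R\<^esub> f'' (inv\<^bsub>H\<^esub> h \<otimes>\<^bsub>H\<^esub> g))"
        unfolding mult_ap[OF g] using f g
        by (intro R.finsum_cong') (auto simp: cl add_ap R.l_distr)
      also have "\<dots> = (f \<otimes>\<^bsub>?A\<^esub> f'' \<oplus>\<^bsub>?A\<^esub> f' \<otimes>\<^bsub>?A\<^esub> f'') g"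
        unfolding add_ap[OF g] mult_ap[OF g] using f g by (intro R.finsum_addf) (auto simp: cl)
      finally show "((f \<oplus>\<^bsub>?A\<^esub> f') \<otimes>\<^bsub>?A\<^esub> f'') g = (f \<otimes>\<^bsub>?A\<^esub> f'' \<oplus>\<^bsub>?A\<^esub> f' \<otimes>\<^bsub>?A\<^esub> f'') g" .
    qed (simp_all add: f mult_in add_in)
    show "f'' \<otimes>\<^bsub>?A\<^esub> (f \<oplus>\<^bsub>?A\<^esub> f') = f'' \<otimes>\<^bsub>?A\<^esub> f \<oplus>\<^bsub>?A\<^esub> f'' \<otimes>\<^bsub>?A\<^esub> f'"
    proof (rule eq)
      fix g assume g: "g \<in> carrier H"
      have "(f'' \<otimes>\<^bsub>?A\<^esub> (f \<oplus>\<^bsub>?A\<^esub> f')) g = (\<Oplus>\<^bsub>R\<^esub>h\<in>carrier H.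
          f'' h \<otimes>\<^bsub>R\<^esub> f (inv\<^bsub>H\<^esub> h \<otimes>\<^bsub>H\<^esub> g) \<oplus>\<^bsub>R\<^esub> f'' h \<otimes>\<^bsub>R\<^esub> f' (inv\<^bsub>H\<^esub> h \<otimes>\<^bsub>H\<^esub> g))"
        unfolding mult_ap[OF g] using f g
        by (intro R.finsum_cong') (auto simp: cl add_ap R.r_distr)
      also have "\<dots> = (f'' \<otimes>\<^bsub>?A\<^esub> f \<oplus>\<^bsub>?A\<^esub> f'' \<otimes>\<^bsub>?A\<^esub> f') g"
        unfolding add_ap[OF g] mult_ap[OF g] using f g by (intro R.finsum_addf) (auto simp: cl)
      finally show "(f'' \<otimes>\<^bsub>?A\<^esub> (f \<oplus>\<^bsub>?A\<^esub> f')) g = (f'' \<otimes>\<^bsub>?A\<^esub> f \<oplus>\<^bsub>?A\<^esub> f'' \<otimes>\<^bsub>?A\<^esub> f') g" .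
    qed (simp_all add: f mult_in add_in)
  qed (auto simp: mult_in, auto simp: group_algebra_def R.a_ac fun_eq_iff PiE_iff extensional_def)
qed

end

theory Submission
  imports Defs
begin

text \<open>
  Let \<open>R\<close> be the group algebra of \<open>C_n \<times> C_2\<close> over \<open>F\<close>, a commutative ring of characteristic 3 with
  \<open>3^(2nk)\<close> elements. Since \<open>D_12 = C_2 \<times> S_3\<close>, we have \<open>FG = R S_3\<close> and \<open>F(C_n \<times> C_2^2) = R C_2\<close>.
  The projection of \<open>S_3\<close> onto \<open>C_2\<close> splits, hence \<open>U(R S_3) = P \<rtimes> U(R C_2)\<close> where \<open>P\<close> consists of
  the units over 1. The coefficient of \<open>(x - 1) y\<close>, with \<open>x\<close> of order 3 and \<open>y\<close> a reflection, is a
  split homomorphism from \<open>P\<close> onto the additive group of \<open>R\<close>; its kernel is abelian of exponent 3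
  and has \<open>|R|^3\<close> elements. Abelian groups of exponent 3 are determined by their order.
\<close>

section \<open>Split extensions and external semidirect products\<close>

text \<open>Bijectivity comes for free, since \<open>\<phi> (inv b)\<close> undoes
  \<open>\<phi> b\<close>. Extensionality is a separate premise because the elements of
  \<open>AutoGroup A\<close> are maps extensional on \<open>carrier A\<close>.\<close>

lemma hom_AutoGroupI:
  assumes "group A" "group B"
    and ext: "\<And>b. b \<in> carrier B \<Longrightarrow> \<phi> b \<in> extensional (carrier A)"
    and hom: "\<And>b. b \<in> carrier B \<Longrightarrow> \<phi> b \<in> hom A A"
    and one: "\<And>a. a \<in> carrier A \<Longrightarrow> \<phi> \<one>\<^bsub>B\<^esub> a = a"
    and mult: "\<And>b b' a. b \<in> carrier B \<Longrightarrow> b' \<in> carrier B \<Longrightarrow> a \<in> carrier A \<Longrightarrow>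
      \<phi> (b \<otimes>\<^bsub>B\<^esub> b') a = \<phi> b (\<phi> b' a)"
  shows "\<phi> \<in> hom B (AutoGroup A)"
proof -
  interpret A: group A by fact
  interpret B: group B by fact
  have cl: "\<phi> b a \<in> carrier A" if "b \<in> carrier B" "a \<in> carrier A" for a b
    using hom_in_carrier[OF hom] that by blast
  have inverse: "\<phi> (inv\<^bsub>B\<^esub> b) (\<phi> b a) = a" "\<phi> b (\<phi> (inv\<^bsub>B\<^esub> b) a) = a"
    if "b \<in> carrier B" "a \<in> carrier A" for a b
    using that mult[of "inv\<^bsub>B\<^esub> b" b a] mult[of b "inv\<^bsub>B\<^esub> b" a] by (simp_all add: one)
  have "bij_betw (\<phi> b) (carrier A) (carrier A)" if "b \<in> carrier B" for b
    using that by (intro bij_betwI[where g = "\<phi> (inv\<^bsub>B\<^esub> b)"]) (auto simp: cl inverse)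
  then have auto: "\<phi> b \<in> auto A" if "b \<in> carrier B" for b
    using that ext hom by (simp add: auto_def Bij_def)
  show ?thesis
  proof (rule homI)
    fix b b' assume b: "b \<in> carrier B" "b' \<in> carrier B"
    show "\<phi> (b \<otimes>\<^bsub>B\<^esub> b') = \<phi> b \<otimes>\<^bsub>AutoGroup A\<^esub> \<phi> b'"
    proof (rule extensionalityI[of _ "carrier A"])
      show "\<phi> b \<otimes>\<^bsub>AutoGroup A\<^esub> \<phi> b' \<in> extensional (carrier A)"
        using b auto[of b] auto[of b'] by (simp add: AutoGroup_def BijGroup_def auto_def)
    qed (use b ext auto in \<open>auto simp: mult AutoGroup_def BijGroup_def auto_def compose_def\<close>)
  qed (simp add: auto AutoGroup_def)
qed

text \<open>Conjugation by \<open>s b\<close> preserves the kernel of \<open>p\<close>; pulled back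
  along \<open>h\<close> it is the action, and \<open>(a, b) \<mapsto> h a \<otimes> s b\<close> is
  the isomorphism.\<close>

lemma semidirect_product_iso_split_extension:
  assumes "group G" "group A" "group B"
    and p: "p \<in> hom G B" and s: "s \<in> hom B G"
    and ps: "\<And>b. b \<in> carrier B \<Longrightarrow> p (s b) = b"
    and h: "h \<in> hom A G" and inj: "inj_on h (carrier A)"
    and img: "h ` carrier A = kernel G B p"
  shows "\<exists>\<phi>\<in>hom B (AutoGroup A). semidirect_product A B \<phi> \<cong> G"
proof -
  interpret G: group G by fact
  interpret A: group A by fact
  interpret B: group B by fact
  interpret p: group_hom G B p by unfold_locales fact
  interpret s: group_hom B G s by unfold_locales fact
  interpret h: group_hom A G h by unfold_locales fact
  define conj where "conj b x = s b \<otimes>\<^bsub>G\<^esub> x \<otimes>\<^bsub>G\<^esub> inv\<^bsub>G\<^esub> (s b)" for b x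
  define \<phi> where "\<phi> b = (\<lambda>a\<in>carrier A. inv_into (carrier A) h (conj b (h a)))" for b
  have hker: "p (h a) = \<one>\<^bsub>B\<^esub>" if "a \<in> carrier A" for a
    using img that by (auto simp: kernel_def)
  have ex: "x \<in> h ` carrier A" if "x \<in> carrier G" "p x = \<one>\<^bsub>B\<^esub>" for x
    using img that by (auto simp: kernel_def)
  have conj_in: "conj b (h a) \<in> h ` carrier A" if "b \<in> carrier B" "a \<in> carrier A" for a b
    using that by (intro ex) (auto simp: conj_def hker ps)
  have \<phi>_in: "\<phi> b a \<in> carrier A" and h\<phi>: "h (\<phi> b a) = conj b (h a)"
    if "b \<in> carrier B" "a \<in> carrier A" for a b
    using conj_in[OF that] that inv_into_into[of "conj b (h a)" h "carrier A"]
    by (auto simp: \<phi>_def f_inv_into_f)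
  have eqI: "a = a'" if "h a = h a'" "a \<in> carrier A" "a' \<in> carrier A" for a a'
    using inj that by (auto dest: inj_onD)
  have cancel: "inv\<^bsub>G\<^esub> x \<otimes>\<^bsub>G\<^esub> (x \<otimes>\<^bsub>G\<^esub> y) = y" if "x \<in> carrier G" "y \<in> carrier G" for x y
    using that by (simp add: G.m_assoc[symmetric])
  have \<phi>: "\<phi> \<in> hom B (AutoGroup A)"
  proof (rule hom_AutoGroupI)
    fix b assume b: "b \<in> carrier B"
    show "\<phi> b \<in> hom A A"
      using b by (intro homI eqI) (auto simp: \<phi>_in h\<phi> conj_def G.m_assoc cancel)
  next
    fix b b' a assume "b \<in> carrier B" "b' \<in> carrier B" "a \<in> carrier A"
    then show "\<phi> (b \<otimes>\<^bsub>B\<^esub> b') a = \<phi> b (\<phi> b' a)"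
      by (intro eqI) (auto simp: \<phi>_in h\<phi> conj_def G.m_assoc G.inv_mult_group)
  next
    fix a assume "a \<in> carrier A"
    then show "\<phi> \<one>\<^bsub>B\<^esub> a = a"
      by (intro eqI) (auto simp: \<phi>_in h\<phi> conj_def)
  qed (auto simp: \<phi>_def assms)
  let ?f = "\<lambda>(a, b). h a \<otimes>\<^bsub>G\<^esub> s b"
  have hom: "?f \<in> hom (semidirect_product A B \<phi>) G"
    by (rule homI) (auto simp: semidirect_product_def \<phi>_in h\<phi> conj_def G.m_assoc cancel)
  \<comment> \<open>\<open>p\<close> reads off the second component of a product; this gives
    injectivity, the first component being recovered through \<open>h\<close>.\<close>
  have pf: "p (h a \<otimes>\<^bsub>G\<^esub> s b) = b" if "a \<in> carrier A" "b \<in> carrier B" for a b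
    using that by (simp add: hker ps)
  have "bij_betw ?f (carrier A \<times> carrier B) (carrier G)"
  proof (rule bij_betw_imageI[OF inj_onI subset_antisym[OF _ subsetI]])
    fix u v assume uv: "u \<in> carrier A \<times> carrier B" "v \<in> carrier A \<times> carrier B" "?f u = ?f v"
    obtain a b a' b' where [simp]: "u = (a, b)" "v = (a', b')" by force
    have "b = b'" using uv pf[of a b] pf[of a' b'] by simp
    moreover have "h a = h a'" using uv \<open>b = b'\<close> by simp
    ultimately show "u = v" using uv eqI[of a a'] by simp
  next
    fix x assume x: "x \<in> carrier G"
    \<comment> \<open>Dividing \<open>x\<close> by its image \<open>s (p x)\<close> in the
      complement leaves an element of the kernel, which supplies the first component.\<close>
    then have "x \<otimes>\<^bsub>G\<^esub> inv\<^bsub>G\<^esub> (s (p x)) \<in> h ` carrier A"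
      by (intro ex) (auto simp: ps)
    then obtain a where a: "a \<in> carrier A" "h a = x \<otimes>\<^bsub>G\<^esub> inv\<^bsub>G\<^esub> (s (p x))" by auto
    then have "x = ?f (a, p x)" using x by (simp add: G.m_assoc)
    moreover have "(a, p x) \<in> carrier A \<times> carrier B" using a(1) x by simp
    ultimately show "x \<in> ?f ` (carrier A \<times> carrier B)" by (rule image_eqI)
  qed auto
  then have "?f \<in> iso (semidirect_product A B \<phi>) G"
    using hom by (auto simp: iso_def semidirect_product_def)
  with \<phi> show ?thesis by (auto simp: is_iso_def)
qed

text \<open>Here kernel and quotient are only given up to isomorphism, so that standard groups such
  as \<open>cyclic_power\<close> can serve as factors.\<close>

corollary split_extension_iso_semidirect_product:
  assumes "group G" "group A" "group B" "group Q"
    and p: "p \<in> hom G Q" and s: "s \<in> hom Q G"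
    and ps: "\<And>x. x \<in> carrier Q \<Longrightarrow> p (s x) = x"
    and A: "A \<cong> G\<lparr>carrier := kernel G Q p\<rparr>" and B: "B \<cong> Q"
  shows "\<exists>\<phi>\<in>hom B (AutoGroup A). G \<cong> semidirect_product A B \<phi>"
proof -
  interpret B: group B by fact
  interpret p: group_hom G Q p using assms(1,4) p by (simp add: group_hom_def group_hom_axioms_def)
  obtain h where h: "h \<in> iso A (G\<lparr>carrier := kernel G Q p\<rparr>)" using A by (auto simp: is_iso_def)
  obtain e where e: "e \<in> iso B Q" using B by (auto simp: is_iso_def)
  define e' where "e' = inv_into (carrier B) e"
  have e': "e' \<in> iso Q B" unfolding e'_def by (rule B.iso_set_sym[OF e])
  have bij: "bij_betw e (carrier B) (carrier Q)" using e by (simp add: iso_def)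
  have e'e: "e' (e b) = b" if "b \<in> carrier B" for b
    unfolding e'_def by (rule bij_betw_inv_into_left[OF bij that])
  have ee': "e (e' x) = x" if "x \<in> carrier Q" for x
    unfolding e'_def by (rule bij_betw_inv_into_right[OF bij that])
  have e_hom: "e \<in> hom B Q" "e' \<in> hom Q B" using e e' by (auto simp: iso_def)
  \<comment> \<open>\<open>e'\<close> sends only the identity to the identity, so composing with it
    leaves the kernel of \<open>p\<close> unchanged.\<close>
  have "e' x = \<one>\<^bsub>B\<^esub> \<longleftrightarrow> x = \<one>\<^bsub>Q\<^esub>" if "x \<in> carrier Q" for x
    using that ee'[OF that] hom_one[OF e_hom(1) assms(3,4)] hom_one[OF e_hom(2) assms(4,3)] by auto
  then have ker: "kernel G B (e' \<circ> p) = kernel G Q p" by (auto simp: kernel_def)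
  have "\<exists>\<phi>\<in>hom B (AutoGroup A). semidirect_product A B \<phi> \<cong> G"
  proof (rule semidirect_product_iso_split_extension)
    show "e' \<circ> p \<in> hom G B" by (rule hom_compose[OF p e_hom(2)])
    show "s \<circ> e \<in> hom B G" by (rule hom_compose[OF e_hom(1) s])
    show "(e' \<circ> p) ((s \<circ> e) b) = b" if "b \<in> carrier B" for b
      using that hom_in_carrier[OF e_hom(1) that] by (simp add: ps e'e)
    show "h \<in> hom A G" using h by (auto simp: iso_def hom_def kernel_def)
    show "inj_on h (carrier A)" "h ` carrier A = kernel G B (e' \<circ> p)"
      using h by (auto simp: iso_def bij_betw_def ker)
  qed fact+
  then show ?thesis
    using assms(2,3) group.iso_sym[OF semidirect_product_is_group] by blast
qed

section \<open>Elementary abelian groups\<close>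

lemma group_cyclic_power [simp]: "group (cyclic_power p j)"
  by (simp add: cyclic_power_def)

text \<open>As for a basis of a vector space: an embedding of \<open>cyclic_power p j\<close> is
  extended by one generator as long as its image is a proper subgroup; at \<open>j = m\<close> the
  orders agree and it is onto.\<close>

lemma elementary_abelian_iso_cyclic_power:
  assumes "comm_group G" and p: "Factorial_Ring.prime p" and card: "card (carrier G) = p ^ m"
    and exp: "\<And>x. x \<in> carrier G \<Longrightarrow> x [^]\<^bsub>G\<^esub> p = \<one>\<^bsub>G\<^esub>"
  shows "cyclic_power p m \<cong> G"
proof -
  interpret G: comm_group G by fact
  have p0: "p > 0" and fin: "finite (carrier G)"
    using p card by (auto simp: prime_gt_0_nat intro: card_ge_0_finite)
  have card_cp: "card (carrier (cyclic_power p j)) = p ^ j" for j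
    using p0 by (simp add: cyclic_power_def card_PiE carrier_integer_mod_group)
  \<comment> \<open>Exponents only matter modulo \<open>p\<close>, which makes powers of
    \<open>g\<close> compatible with addition in \<open>integer_mod_group p\<close>.\<close>
  have pow_mod: "g [^]\<^bsub>G\<^esub> (i mod int p) = g [^]\<^bsub>G\<^esub> i" if "g \<in> carrier G" for g i
  proof -
    have "g [^]\<^bsub>G\<^esub> i = g [^]\<^bsub>G\<^esub> (int p * (i div int p) + i mod int p)" by simp
    also have "\<dots> = (g [^]\<^bsub>G\<^esub> int p) [^]\<^bsub>G\<^esub> (i div int p) \<otimes>\<^bsub>G\<^esub> g [^]\<^bsub>G\<^esub> (i mod int p)"
      using that by (simp only: G.int_pow_mult G.int_pow_pow)
    also have "g [^]\<^bsub>G\<^esub> int p = \<one>\<^bsub>G\<^esub>" using exp[OF that] by (simp add: int_pow_int)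
    finally show ?thesis using that by simp
  qed
  have "\<exists>f\<in>hom (cyclic_power p j) G. inj_on f (carrier (cyclic_power p j))" if "j \<le> m" for j
    using that
  proof (induction j)
    case 0
    show ?case
      by (intro bexI[of _ "\<lambda>_. \<one>\<^bsub>G\<^esub>"] homI) (auto simp: cyclic_power_def)
  next
    case (Suc j)
    then obtain f where f: "f \<in> hom (cyclic_power p j) G"
      and inj: "inj_on f (carrier (cyclic_power p j))" by auto
    interpret f: group_hom "cyclic_power p j" G f
      using f by (intro group_hom.intro) (auto simp: group_hom_axioms_def)
    define H where "H = f ` carrier (cyclic_power p j)"
    have "card H = p ^ j" using card_image[OF inj] by (simp add: H_def card_cp)
    moreover have "p ^ j < p ^ m" using Suc.prems prime_gt_1_nat[OF p] by simp
    ultimately have "H \<noteq> carrier G" using card by auto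
    moreover have H: "subgroup H G" unfolding H_def by (rule f.img_is_subgroup)
    ultimately obtain g where g: "g \<in> carrier G" "g \<notin> H"
      using subgroup.subset[OF H] by blast
    \<comment> \<open>The powers of \<open>g\<close> meet \<open>H\<close> trivially: an exponent
      nonzero modulo \<open>p\<close> has an inverse \<open>c\<close> by Bezout, which would bring
      \<open>g\<close> itself into \<open>H\<close>.\<close>
    have power_in: "a = 0" if "g [^]\<^bsub>G\<^esub> a \<in> H" "0 \<le> a" "a < int p" for a :: int
    proof (rule ccontr)
      assume "a \<noteq> 0"
      with that have "\<not> int p dvd a" by (auto dest: zdvd_imp_le)
      then have "coprime (int p) a" using p by (intro prime_imp_coprime) auto
      then obtain c d where "c * a + d * int p = 1"
        using bezout_int[of a "int p"] by (metis coprime_commute coprime_imp_gcd_eq_1)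
      then have "a * c mod int p = 1 mod int p"
        using mod_mult_self1[of "c * a" d "int p"] by (simp add: mult.commute)
      then have "(g [^]\<^bsub>G\<^esub> a) [^]\<^bsub>G\<^esub> c = g"
        using pow_mod[OF g(1), of "a * c"] pow_mod[OF g(1), of 1] g(1)
        by (simp add: G.int_pow_pow)
      then show False using g(2) G.subgroup_int_pow_closed[OF H that(1), of c] by simp
    qed
    \<comment> \<open>\<open>r\<close> drops the last coordinate, and \<open>f'\<close> turns that
      coordinate into the exponent of the new generator \<open>g\<close>.\<close>
    define r where "r v = restrict v {..<j}" for v :: "nat \<Rightarrow> int"
    define f' where "f' v = f (r v) \<otimes>\<^bsub>G\<^esub> g [^]\<^bsub>G\<^esub> v j" for v
    have r: "r v \<in> carrier (cyclic_power p j)" if "v \<in> carrier (cyclic_power p (Suc j))" for v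
      using that by (auto simp: cyclic_power_def r_def PiE_iff)
    have r_mult: "r (v \<otimes>\<^bsub>cyclic_power p (Suc j)\<^esub> w) = r v \<otimes>\<^bsub>cyclic_power p j\<^esub> r w" for v w
      by (auto simp: cyclic_power_def r_def fun_eq_iff)
    have "f' \<in> hom (cyclic_power p (Suc j)) G"
    proof (rule homI)
      fix v w assume vw: "v \<in> carrier (cyclic_power p (Suc j))" "w \<in> carrier (cyclic_power p (Suc j))"
      have "(v \<otimes>\<^bsub>cyclic_power p (Suc j)\<^esub> w) j = (v j + w j) mod int p"
        by (simp add: cyclic_power_def)
      then show "f' (v \<otimes>\<^bsub>cyclic_power p (Suc j)\<^esub> w) = f' v \<otimes>\<^bsub>G\<^esub> f' w"
        using vw r g(1) by (simp add: f'_def r_mult pow_mod G.int_pow_mult G.m_ac)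
    qed (auto simp: f'_def r g)
    moreover have "inj_on f' (carrier (cyclic_power p (Suc j)))"
    proof -
      interpret f': group_hom "cyclic_power p (Suc j)" G f'
        using calculation by (intro group_hom.intro) (auto simp: group_hom_axioms_def)
      have "v = \<one>\<^bsub>cyclic_power p (Suc j)\<^esub>"
        if v: "v \<in> carrier (cyclic_power p (Suc j))" and 1: "f' v = \<one>\<^bsub>G\<^esub>" for v
      proof -
        have fr: "f (r v) \<in> H" using r[OF v] by (simp add: H_def)
        have "g [^]\<^bsub>G\<^esub> v j = inv\<^bsub>G\<^esub> f (r v)"
          using 1 r[OF v] g(1)
          by (intro G.inv_equality[symmetric]) (simp_all add: f'_def G.m_comm)
        then have "g [^]\<^bsub>G\<^esub> v j \<in> H" using subgroup.m_inv_closed[OF H fr] by simp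
        moreover have "0 \<le> v j" "v j < int p"
          using PiE_mem[of v "{..<Suc j}" "\<lambda>_. carrier (integer_mod_group p)" j] v p0
          by (simp_all add: cyclic_power_def carrier_integer_mod_group)
        ultimately have vj: "v j = 0" by (rule power_in)
        then have "f (r v) = \<one>\<^bsub>G\<^esub>" using 1 r[OF v] by (simp add: f'_def)
        then have rv: "r v = \<one>\<^bsub>cyclic_power p j\<^esub>"
          using inj r[OF v] by (simp add: f.inj_on_one_iff)
        show ?thesis
        proof
          fix i
          consider "i < j" | "i = j" | "i > j" by linarith
          then show "v i = \<one>\<^bsub>cyclic_power p (Suc j)\<^esub> i"
          proof cases
            case 1
            have "r v i = \<one>\<^bsub>cyclic_power p j\<^esub> i" by (simp only: rv)
            with 1 show ?thesis by (simp add: r_def cyclic_power_def)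
          next
            case 2
            with vj show ?thesis by (simp add: cyclic_power_def)
          next
            case 3
            with v show ?thesis
              using PiE_arb[of v "{..<Suc j}" "\<lambda>_. carrier (integer_mod_group p)" i]
              by (simp add: cyclic_power_def)
          qed
        qed
      qed
      then show ?thesis by (simp add: f'.inj_on_one_iff)
    qed
    ultimately show ?case by blast
  qed
  then obtain f where f: "f \<in> hom (cyclic_power p m) G"
    and inj: "inj_on f (carrier (cyclic_power p m))" by auto
  have "f ` carrier (cyclic_power p m) = carrier G"
    using f fin card card_image[OF inj]
    by (intro card_subset_eq) (auto simp: card_cp hom_def)
  with f inj show ?thesis by (auto simp: is_iso_def iso_def bij_betw_def)
qed

section \<open>Transport of unit groups\<close>

text \<open>\<open>hom\<close> concerns multiplication alone, and a multiplicative map of monoids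
  may move the identity; hence the explicit premise on \<open>\<one>\<close>.\<close>

lemma hom_Units:
  assumes h: "h \<in> hom A B" and one: "h \<one>\<^bsub>A\<^esub> = \<one>\<^bsub>B\<^esub>" and x: "x \<in> Units A"
  shows "h x \<in> Units B"
proof -
  obtain y where y: "y \<in> carrier A" "x \<otimes>\<^bsub>A\<^esub> y = \<one>\<^bsub>A\<^esub>" "y \<otimes>\<^bsub>A\<^esub> x = \<one>\<^bsub>A\<^esub>" and "x \<in> carrier A"
    using x by (auto simp: Units_def)
  then have "h x \<otimes>\<^bsub>B\<^esub> h y = \<one>\<^bsub>B\<^esub>" "h y \<otimes>\<^bsub>B\<^esub> h x = \<one>\<^bsub>B\<^esub>"
    using hom_mult[OF h] one by metis+
  then show ?thesis
    using hom_in_carrier[OF h] y(1) \<open>x \<in> carrier A\<close> by (auto simp: Units_def)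
qed

lemma hom_units_of:
  assumes "h \<in> hom A B" "h \<one>\<^bsub>A\<^esub> = \<one>\<^bsub>B\<^esub>"
  shows "h \<in> hom (units_of A) (units_of B)"
  using hom_Units[OF assms] hom_mult[OF assms(1)]
  by (intro homI) (auto simp: units_of_def Units_def)

lemma iso_units_of:
  assumes "monoid A" and h: "h \<in> iso A B" and one: "h \<one>\<^bsub>A\<^esub> = \<one>\<^bsub>B\<^esub>"
  shows "units_of A \<cong> units_of B"
proof -
  interpret A: monoid A by fact
  let ?g = "inv_into (carrier A) h"
  have hom: "h \<in> hom A B" and bij: "bij_betw h (carrier A) (carrier B)"
    using h by (auto simp: iso_def)
  have g_in: "?g y \<in> carrier A" if "y \<in> carrier B" for y
    using bij that by (metis bij_betw_def inv_into_into)
  have g: "?g \<in> hom B A"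
  proof (rule homI[OF g_in])
    fix x y assume "x \<in> carrier B" "y \<in> carrier B"
    then show "?g (x \<otimes>\<^bsub>B\<^esub> y) = ?g x \<otimes>\<^bsub>A\<^esub> ?g y"
      using bij by (intro inv_into_f_eq)
        (auto simp: bij_betw_def g_in hom_mult[OF hom] bij_betw_inv_into_right[OF bij])
  qed
  have g_one: "?g \<one>\<^bsub>B\<^esub> = \<one>\<^bsub>A\<^esub>"
    using bij one by (intro inv_into_f_eq) (auto simp: bij_betw_def)
  have "bij_betw h (Units A) (Units B)"
  proof (rule bij_betwI[where g = ?g])
    show "h \<in> Units A \<rightarrow> Units B" using hom_Units[OF hom one] by auto
    show "?g \<in> Units B \<rightarrow> Units A" using hom_Units[OF g g_one] by auto
  qed (use bij in \<open>auto simp: bij_betw_inv_into_left bij_betw_inv_into_right Units_def\<close>)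
  then have "h \<in> iso (units_of A) (units_of B)"
    using hom_units_of[OF hom one] by (simp add: iso_def units_of_carrier)
  then show ?thesis by (auto simp: is_iso_def)
qed

section \<open>Sums and coefficients in group algebras\<close>

text \<open>Serves to split a convolution sum over a product group into an outer and an inner
  sum.\<close>

lemma (in abelian_monoid) finsum_Times:
  assumes "finite A" "finite B" and f: "f \<in> A \<times> B \<rightarrow> carrier G"
  shows "(\<Oplus>p\<in>A \<times> B. f p) = (\<Oplus>b\<in>B. \<Oplus>a\<in>A. f (a, b))"
  using assms(2) f
proof (induction B rule: finite_induct)
  case (insert b B)
  have "(\<Oplus>p\<in>A \<times> insert b B. f p) = (\<Oplus>p\<in>(\<lambda>a. (a, b)) ` A \<union> A \<times> B. f p)"
    by (rule arg_cong[where f = "finsum G f"]) auto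
  also have "\<dots> = (\<Oplus>p\<in>(\<lambda>a. (a, b)) ` A. f p) \<oplus> (\<Oplus>p\<in>A \<times> B. f p)"
    using insert assms(1) by (intro finsum_Un_disjoint) auto
  also have "(\<Oplus>p\<in>(\<lambda>a. (a, b)) ` A. f p) = (\<Oplus>a\<in>A. f (a, b))"
    using insert by (intro finsum_reindex) (auto simp: inj_on_def)
  also have "(\<Oplus>p\<in>A \<times> B. f p) = (\<Oplus>b\<in>B. \<Oplus>a\<in>A. f (a, b))"
    using insert by (intro insert.IH) auto
  also have "(\<Oplus>a\<in>A. f (a, b)) \<oplus> \<dots> = (\<Oplus>b\<in>insert b B. \<Oplus>a\<in>A. f (a, b))"
    using insert by (subst finsum_insert) (auto intro!: finsum_closed)
  finally show ?case .
qed simp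

lemma carrier_group_algebra: "carrier (group_algebra R H) = carrier H \<rightarrow>\<^sub>E carrier R"
  by (simp add: group_algebra_def)

lemma group_algebra_apply:
  assumes "g \<in> carrier H"
  shows "(f \<otimes>\<^bsub>group_algebra R H\<^esub> f') g =
      (\<Oplus>\<^bsub>R\<^esub>h\<in>carrier H. f h \<otimes>\<^bsub>R\<^esub> f' (inv\<^bsub>H\<^esub> h \<otimes>\<^bsub>H\<^esub> g))"
    and "\<one>\<^bsub>group_algebra R H\<^esub> g = (if g = \<one>\<^bsub>H\<^esub> then \<one>\<^bsub>R\<^esub> else \<zero>\<^bsub>R\<^esub>)"
    and "\<zero>\<^bsub>group_algebra R H\<^esub> g = \<zero>\<^bsub>R\<^esub>"
    and "(f \<oplus>\<^bsub>group_algebra R H\<^esub> f') g = f g \<oplus>\<^bsub>R\<^esub> f' g"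
  using assms by (simp_all add: group_algebra_def)

lemma group_algebra_eqI:
  assumes "f \<in> carrier (group_algebra R H)" "f' \<in> carrier (group_algebra R H)"
    and "\<And>g. g \<in> carrier H \<Longrightarrow> f g = f' g"
  shows "f = f'"
  using assms PiE_ext[of f "carrier H" "\<lambda>_. carrier R" f'] by (simp add: carrier_group_algebra)

lemma group_algebra_in_carrier:
  assumes "f \<in> carrier (group_algebra R H)" "g \<in> carrier H"
  shows "f g \<in> carrier R"
  using assms by (auto simp: carrier_group_algebra)

lemma card_group_algebra:
  "finite (carrier H) \<Longrightarrow> card (carrier (group_algebra R H)) = card (carrier R) ^ card (carrier H)"
  by (simp add: carrier_group_algebra card_PiE)

text \<open>Evaluation at \<open>g\<close> is additive. This is for convolutions whose coefficients
  are themselves elements of a group algebra.\<close>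

lemma finsum_group_algebra_apply:
  assumes "ring R" "group H" "finite (carrier H)" "finite I"
    and "\<And>i. i \<in> I \<Longrightarrow> f i \<in> carrier (group_algebra R H)" and g: "g \<in> carrier H"
  shows "(\<Oplus>\<^bsub>group_algebra R H\<^esub>i\<in>I. f i) g = (\<Oplus>\<^bsub>R\<^esub>i\<in>I. f i g)"
proof -
  interpret R: ring R by fact
  interpret A: ring "group_algebra R H" using assms(1-3) by (rule group_algebra_is_ring)
  show ?thesis
    using assms(4,5)
  proof (induction I rule: finite_induct)
    case empty
    show ?case using g by (simp add: group_algebra_apply)
  next
    case (insert i I)
    then have "(\<Oplus>\<^bsub>group_algebra R H\<^esub>i\<in>insert i I. f i) g
        = (f i \<oplus>\<^bsub>group_algebra R H\<^esub> (\<Oplus>\<^bsub>group_algebra R H\<^esub>i\<in>I. f i)) g"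
      by (subst A.finsum_insert) auto
    also have "\<dots> = f i g \<oplus>\<^bsub>R\<^esub> (\<Oplus>\<^bsub>R\<^esub>i\<in>I. f i g)"
      using insert g by (simp add: group_algebra_apply)
    also have "\<dots> = (\<Oplus>\<^bsub>R\<^esub>i\<in>insert i I. f i g)"
      using insert g by (subst R.finsum_insert) (auto intro: group_algebra_in_carrier)
    finally show ?case .
  qed
qed

text \<open>For abelian \<open>H\<close> the substitution
  \<open>h \<mapsto> inv h \<otimes> g\<close> permutes \<open>carrier H\<close> and exchanges the
  two arguments in each term of the convolution.\<close>

lemma group_algebra_is_cring:
  assumes "cring R" "comm_group H" and fin: "finite (carrier H)"
  shows "cring (group_algebra R H)"
proof -
  interpret R: cring R by fact
  interpret H: comm_group H by fact
  interpret A: ring "group_algebra R H"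
    using R.ring_axioms H.is_group fin by (rule group_algebra_is_ring)
  note [simp] = group_algebra_in_carrier
  have "f \<otimes>\<^bsub>group_algebra R H\<^esub> f' = f' \<otimes>\<^bsub>group_algebra R H\<^esub> f"
    if f: "f \<in> carrier (group_algebra R H)" "f' \<in> carrier (group_algebra R H)" for f f'
  proof (rule group_algebra_eqI)
    fix g assume g: "g \<in> carrier H"
    have inv2: "inv\<^bsub>H\<^esub> (inv\<^bsub>H\<^esub> h \<otimes>\<^bsub>H\<^esub> g) \<otimes>\<^bsub>H\<^esub> g = h" if "h \<in> carrier H" for h
      using that g by (simp add: H.inv_mult_group H.m_assoc H.m_comm[of _ h])
    have bij: "bij_betw (\<lambda>h. inv\<^bsub>H\<^esub> h \<otimes>\<^bsub>H\<^esub> g) (carrier H) (carrier H)"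
      using g inv2
      by (intro bij_betwI[where g = "\<lambda>h. inv\<^bsub>H\<^esub> h \<otimes>\<^bsub>H\<^esub> g"]) auto
    have "(f \<otimes>\<^bsub>group_algebra R H\<^esub> f') g
        = (\<Oplus>\<^bsub>R\<^esub>h\<in>(\<lambda>h. inv\<^bsub>H\<^esub> h \<otimes>\<^bsub>H\<^esub> g) ` carrier H. f h \<otimes>\<^bsub>R\<^esub> f' (inv\<^bsub>H\<^esub> h \<otimes>\<^bsub>H\<^esub> g))"
      using g bij by (simp add: group_algebra_apply bij_betw_def)
    also have "\<dots> = (\<Oplus>\<^bsub>R\<^esub>h\<in>carrier H. f (inv\<^bsub>H\<^esub> h \<otimes>\<^bsub>H\<^esub> g) \<otimes>\<^bsub>R\<^esub>
        f' (inv\<^bsub>H\<^esub> (inv\<^bsub>H\<^esub> h \<otimes>\<^bsub>H\<^esub> g) \<otimes>\<^bsub>H\<^esub> g))"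
      using f g bij by (intro R.finsum_reindex) (auto simp: bij_betw_def)
    also have "\<dots> = (f' \<otimes>\<^bsub>group_algebra R H\<^esub> f) g"
      unfolding group_algebra_apply(1)[OF g] using f g
      by (intro R.finsum_cong') (auto simp: inv2 R.m_comm)
    finally show "(f \<otimes>\<^bsub>group_algebra R H\<^esub> f') g = (f' \<otimes>\<^bsub>group_algebra R H\<^esub> f) g" .
  qed (use f in auto)
  then show ?thesis
    by (intro cring.intro A.ring_axioms comm_monoid.intro comm_monoid_axioms.intro A.monoid_axioms)
qed

section \<open>The group algebra of a direct product\<close>

text \<open>This is \<open>F(Z \<times> S) = (FZ)S\<close>: the coefficient of \<open>s\<close> is
  the part of \<open>f\<close> on the coset \<open>h (Z \<times> {s})\<close>. Only multiplication
  and unity are compared, as the aim is unit groups.\<close>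

lemma group_algebra_curry:
  assumes "ring F" "group Z" "group S" "group G"
    and fin: "finite (carrier Z)" "finite (carrier S)" and iso: "h \<in> iso (Z \<times>\<times> S) G"
  defines "c \<equiv> \<lambda>f. \<lambda>s\<in>carrier S. \<lambda>z\<in>carrier Z. f (h (z, s))"
  shows "c \<in> iso (group_algebra F G) (group_algebra (group_algebra F Z) S)"
    and "c \<one>\<^bsub>group_algebra F G\<^esub> = \<one>\<^bsub>group_algebra (group_algebra F Z) S\<^esub>"
proof -
  interpret F: ring F by fact
  interpret Z: group Z by fact
  interpret S: group S by fact
  interpret G: group G by fact
  interpret ZS: group "Z \<times>\<times> S" by (rule DirProd_group) fact+
  have hhom: "h \<in> hom (Z \<times>\<times> S) G" and bij: "bij_betw h (carrier Z \<times> carrier S) (carrier G)"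
    using iso by (auto simp: iso_def DirProd_def)
  interpret h: group_hom "Z \<times>\<times> S" G h by unfold_locales fact
  have finG: "finite (carrier G)" using bij fin by (metis bij_betw_finite finite_cartesian_product)
  let ?FG = "group_algebra F G" and ?FZ = "group_algebra F Z"
  let ?FZS = "group_algebra ?FZ S"
  interpret FG: ring ?FG by (rule group_algebra_is_ring) fact+
  interpret FZ: ring ?FZ by (rule group_algebra_is_ring) fact+
  interpret FZS: ring ?FZS by (rule group_algebra_is_ring) (use FZ.ring_axioms S.is_group fin in auto)
  have h_in: "h (z, s) \<in> carrier G" if "z \<in> carrier Z" "s \<in> carrier S" for z s
    using that bij by (auto simp: bij_betw_def)
  \<comment> \<open>The argument of the second factor in a convolution splits into its
    \<open>Z\<close> and \<open>S\<close> components.\<close>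
  have h_div: "inv\<^bsub>G\<^esub> h (u, t) \<otimes>\<^bsub>G\<^esub> h (z, s) = h (inv\<^bsub>Z\<^esub> u \<otimes>\<^bsub>Z\<^esub> z, inv\<^bsub>S\<^esub> t \<otimes>\<^bsub>S\<^esub> s)"
    if "u \<in> carrier Z" "z \<in> carrier Z" "t \<in> carrier S" "s \<in> carrier S" for u z t s
    using that h.hom_inv[of "(u, t)"] h.hom_mult[of "(inv\<^bsub>Z\<^esub> u, inv\<^bsub>S\<^esub> t)" "(z, s)"]
    by (simp add: inv_DirProd[OF Z.is_group S.is_group])
  have h_one: "h (z, s) = \<one>\<^bsub>G\<^esub> \<longleftrightarrow> z = \<one>\<^bsub>Z\<^esub> \<and> s = \<one>\<^bsub>S\<^esub>" if "z \<in> carrier Z" "s \<in> carrier S" for z s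
    using that h.hom_one inj_on_eq_iff[OF bij_betw_imp_inj_on[OF bij], of "(z, s)" "(\<one>\<^bsub>Z\<^esub>, \<one>\<^bsub>S\<^esub>)"]
    by auto
  note [simp] = group_algebra_in_carrier
  have c_in: "c f s \<in> carrier ?FZ" if "f \<in> carrier ?FG" "s \<in> carrier S" for f s
    using that h_in by (auto simp: c_def carrier_group_algebra)
  have c_closed: "c f \<in> carrier ?FZS" if "f \<in> carrier ?FG" for f
    using c_in[OF that] by (auto simp: c_def carrier_group_algebra[of "?FZ" S])
  have eqI: "f = f'" if "f \<in> carrier ?FZS" "f' \<in> carrier ?FZS"
    "\<And>s z. s \<in> carrier S \<Longrightarrow> z \<in> carrier Z \<Longrightarrow> f s z = f' s z" for f f'
    using that by (intro group_algebra_eqI[of f "?FZ" S f'] group_algebra_eqI[of "f _" F Z "f' _"]) auto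
  have "c \<in> hom ?FG ?FZS"
  proof (rule homI)
    fix f f' assume f: "f \<in> carrier ?FG" "f' \<in> carrier ?FG"
    show "c (f \<otimes>\<^bsub>?FG\<^esub> f') = c f \<otimes>\<^bsub>?FZS\<^esub> c f'"
    proof (rule eqI)
      fix s z assume s: "s \<in> carrier S" and z: "z \<in> carrier Z"
      have "c (f \<otimes>\<^bsub>?FG\<^esub> f') s z
          = (\<Oplus>\<^bsub>F\<^esub>x\<in>h ` (carrier Z \<times> carrier S). f x \<otimes>\<^bsub>F\<^esub> f' (inv\<^bsub>G\<^esub> x \<otimes>\<^bsub>G\<^esub> h (z, s)))"
        using s z h_in bij by (simp add: c_def group_algebra_apply bij_betw_def)
      also have "\<dots> = (\<Oplus>\<^bsub>F\<^esub>p\<in>carrier Z \<times> carrier S. f (h p) \<otimes>\<^bsub>F\<^esub> f' (inv\<^bsub>G\<^esub> h p \<otimes>\<^bsub>G\<^esub> h (z, s)))"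
        using s z f h_in bij by (intro F.finsum_reindex) (auto simp: bij_betw_def)
      \<comment> \<open>The sum over \<open>carrier Z\<close> is going to be the product in
        \<open>group_algebra F Z\<close>, the sum over \<open>carrier S\<close> the outer
        convolution.\<close>
      also have "\<dots> = (\<Oplus>\<^bsub>F\<^esub>t\<in>carrier S. \<Oplus>\<^bsub>F\<^esub>u\<in>carrier Z.
          f (h (u, t)) \<otimes>\<^bsub>F\<^esub> f' (inv\<^bsub>G\<^esub> h (u, t) \<otimes>\<^bsub>G\<^esub> h (z, s)))"
        using s z f h_in fin by (intro F.finsum_Times) auto
      also have "\<dots> = (\<Oplus>\<^bsub>F\<^esub>t\<in>carrier S. (c f t \<otimes>\<^bsub>?FZ\<^esub> c f' (inv\<^bsub>S\<^esub> t \<otimes>\<^bsub>S\<^esub> s)) z)"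
        using s z f h_in
        by (intro F.finsum_cong')
          (auto simp: c_def group_algebra_apply h_div intro!: F.finsum_cong' F.finsum_closed)
      also have "\<dots> = (c f \<otimes>\<^bsub>?FZS\<^esub> c f') s z"
        using s z f fin c_in
        by (simp add: group_algebra_apply(1)[of s S]
            finsum_group_algebra_apply[OF F.ring_axioms Z.is_group])
      finally show "c (f \<otimes>\<^bsub>?FG\<^esub> f') s z = (c f \<otimes>\<^bsub>?FZS\<^esub> c f') s z" .
    qed (use f in \<open>auto simp: c_closed\<close>)
  qed (rule c_closed)
  moreover have "bij_betw c (carrier ?FG) (carrier ?FZS)"
  proof (rule bij_betw_imageI[OF inj_onI subset_antisym[OF _ subsetI]])
    fix f f' assume f: "f \<in> carrier ?FG" "f' \<in> carrier ?FG" "c f = c f'"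
    show "f = f'"
    proof (rule group_algebra_eqI[OF f(1,2)])
      fix g assume "g \<in> carrier G"
      then have "g \<in> h ` (carrier Z \<times> carrier S)" using bij by (simp add: bij_betw_def)
      then obtain z s where "z \<in> carrier Z" "s \<in> carrier S" "g = h (z, s)" by auto
      then show "f g = f' g"
        using fun_cong[OF fun_cong[OF f(3), of s], of z] by (simp add: c_def)
    qed
  next
    fix f assume f: "f \<in> carrier ?FZS"
    \<comment> \<open>The preimage of \<open>f\<close> is obtained by uncurrying along the inverse
      of \<open>h\<close>.\<close>
    let ?i = "inv_into (carrier Z \<times> carrier S) h"
    let ?f = "\<lambda>g\<in>carrier G. f (snd (?i g)) (fst (?i g))"
    have i: "?i g \<in> carrier Z \<times> carrier S" if "g \<in> carrier G" for g
      using that bij by (metis bij_betw_imp_surj_on inv_into_into)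
    have ih: "?i (h (z, s)) = (z, s)" if "z \<in> carrier Z" "s \<in> carrier S" for z s
      using bij that by (simp add: bij_betw_inv_into_left)
    have f': "?f \<in> carrier ?FG"
    proof -
      have "f (snd (?i g)) (fst (?i g)) \<in> carrier F" if "g \<in> carrier G" for g
        using i[OF that] f by (intro group_algebra_in_carrier[of _ F Z] group_algebra_in_carrier[of f _ S]) auto
      then show ?thesis by (auto simp: carrier_group_algebra)
    qed
    have "f = c ?f"
      using f f' h_in by (intro eqI c_closed) (auto simp: c_def ih)
    then show "f \<in> c ` carrier ?FG" using f' by blast
  qed (auto simp: c_closed)
  ultimately show "c \<in> iso ?FG ?FZS" by (simp add: iso_def)
  show "c \<one>\<^bsub>?FG\<^esub> = \<one>\<^bsub>?FZS\<^esub>"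
  proof (rule eqI[OF c_closed])
    fix s z assume "s \<in> carrier S" "z \<in> carrier Z"
    then show "c \<one>\<^bsub>?FG\<^esub> s z = \<one>\<^bsub>?FZS\<^esub> s z"
      by (simp add: c_def group_algebra_apply h_one h_in)
  qed simp_all
qed

corollary units_of_group_algebra_curry:
  assumes "ring F" "group Z" "group S" "group G"
    and fin: "finite (carrier Z)" "finite (carrier S)" and iso: "h \<in> iso (Z \<times>\<times> S) G"
  shows "units_of (group_algebra F G) \<cong> units_of (group_algebra (group_algebra F Z) S)"
proof -
  have "bij_betw h (carrier Z \<times> carrier S) (carrier G)" using iso by (simp add: iso_def)
  then have "finite (carrier G)" using fin by (metis bij_betw_finite finite_cartesian_product)
  then interpret ring "group_algebra F G" using assms by (intro group_algebra_is_ring)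
  show ?thesis
    by (intro iso_units_of[OF monoid_axioms group_algebra_curry(1)[OF assms]])
      (simp add: group_algebra_curry(2)[OF assms])
qed

section \<open>Coordinates in the group algebras of S_3 and C_2\<close>

lemma carrier_dihedral_group_3:
  "carrier (dihedral_group 3) = {(0, False), (1, False), (2, False), (0, True), (1, True), (2, True)}"
proof -
  have "{0..<3::int} = {0, 1, 2}" by auto
  then show ?thesis by (auto simp: dihedral_group_def)
qed

lemma inv_dihedral_group:
  assumes "(i, s) \<in> carrier (dihedral_group m)" "m > 0"
  shows "inv\<^bsub>dihedral_group m\<^esub> (i, s) = (if s then i else (- i) mod int m, s)"
  using assms
  by (intro group.inv_equality[OF dihedral_group_is_group])
    (auto simp: dihedral_group_def mod_simps)

lemma carrier_integer_mod_group_2: "carrier (integer_mod_group 2) = {0, 1}"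
  by (auto simp: carrier_integer_mod_group)

text \<open>The first three arguments are the coefficients at 1, x, x^2, the others those at y, xy,
  x^2 y. Named coordinates turn identities in the algebra into polynomial identities over the
  coefficient ring.\<close>

definition s3_elt :: "'r \<Rightarrow> 'r \<Rightarrow> 'r \<Rightarrow> 'r \<Rightarrow> 'r \<Rightarrow> 'r \<Rightarrow> int \<times> bool \<Rightarrow> 'r"
  where "s3_elt a0 a1 a2 b0 b1 b2 = (\<lambda>(i, s)\<in>carrier (dihedral_group 3).
    if s then (if i = 0 then b0 else if i = 1 then b1 else b2)
    else (if i = 0 then a0 else if i = 1 then a1 else a2))"

definition c2_elt :: "'r \<Rightarrow> 'r \<Rightarrow> int \<Rightarrow> 'r"
  where "c2_elt a b = (\<lambda>i\<in>carrier (integer_mod_group 2). if i = 0 then a else b)"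

lemma s3_elt_apply [simp]:
  "s3_elt a0 a1 a2 b0 b1 b2 (0, False) = a0" "s3_elt a0 a1 a2 b0 b1 b2 (1, False) = a1"
  "s3_elt a0 a1 a2 b0 b1 b2 (2, False) = a2" "s3_elt a0 a1 a2 b0 b1 b2 (0, True) = b0"
  "s3_elt a0 a1 a2 b0 b1 b2 (1, True) = b1" "s3_elt a0 a1 a2 b0 b1 b2 (2, True) = b2"
  by (simp_all add: s3_elt_def carrier_dihedral_group_3)

lemma c2_elt_apply [simp]: "c2_elt a b 0 = a" "c2_elt a b 1 = b"
  by (simp_all add: c2_elt_def)

text \<open>Characteristic 3 is an equation for every element, nested to the right like the sums
  that \<open>a_ac\<close> produces, so that it can act as a rewrite rule.\<close>

locale cring_char3 = cring +
  assumes char3: "x \<in> carrier R \<Longrightarrow> x \<oplus> (x \<oplus> x) = \<zero>"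
begin

abbreviation S3alg :: "(int \<times> bool \<Rightarrow> 'a) ring"
  where "S3alg \<equiv> group_algebra R (dihedral_group 3)"

abbreviation C2alg :: "(int \<Rightarrow> 'a) ring"
  where "C2alg \<equiv> group_algebra R (integer_mod_group 2)"

sublocale S3alg: ring S3alg
  by (rule group_algebra_is_ring[OF ring_axioms dihedral_group_is_group])
    (simp_all add: carrier_dihedral_group_3)

sublocale C2alg: ring C2alg
  by (rule group_algebra_is_ring[OF ring_axioms]) (simp_all add: carrier_integer_mod_group_2)

lemma char3_cancel: "x \<in> carrier R \<Longrightarrow> y \<in> carrier R \<Longrightarrow> x \<oplus> (x \<oplus> (x \<oplus> y)) = y"
  using char3[of x] by (simp add: a_assoc[symmetric])

text \<open>Negation becomes doubling, so that normal forms are plain sums of monomials.\<close>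

lemma a_inv_char3: "x \<in> carrier R \<Longrightarrow> \<ominus> x = x \<oplus> x"
  using char3[of x] by (intro minus_equality) (simp_all add: a_assoc)

text \<open>
  Ordered rewriting with these rules decides polynomial identities modulo 3: the monomials are
  sorted, and three equal ones in a row cancel.
\<close>
lemmas char3_simps = a_inv_char3 minus_eq l_distr r_distr a_ac m_ac char3 char3_cancel

lemma s3_elt_closed [simp]:
  assumes "a0 \<in> carrier R" "a1 \<in> carrier R" "a2 \<in> carrier R"
    "b0 \<in> carrier R" "b1 \<in> carrier R" "b2 \<in> carrier R"
  shows "s3_elt a0 a1 a2 b0 b1 b2 \<in> carrier S3alg"
  using assms
  by (simp add: carrier_group_algebra s3_elt_def restrict_PiE_iff carrier_dihedral_group_3)

lemma s3_elt_cases: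
  assumes "f \<in> carrier S3alg"
  obtains a0 a1 a2 b0 b1 b2 where "f = s3_elt a0 a1 a2 b0 b1 b2"
    "a0 \<in> carrier R" "a1 \<in> carrier R" "a2 \<in> carrier R"
    "b0 \<in> carrier R" "b1 \<in> carrier R" "b2 \<in> carrier R"
proof
  show c: "f (0, False) \<in> carrier R" "f (1, False) \<in> carrier R" "f (2, False) \<in> carrier R"
    "f (0, True) \<in> carrier R" "f (1, True) \<in> carrier R" "f (2, True) \<in> carrier R"
    by (simp_all add: group_algebra_in_carrier[OF assms] carrier_dihedral_group_3)
  show "f = s3_elt (f (0, False)) (f (1, False)) (f (2, False))
      (f (0, True)) (f (1, True)) (f (2, True))"
    using assms c by (intro group_algebra_eqI[of f R]) (auto simp: carrier_dihedral_group_3)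
qed

lemma s3_elt_eq_iff:
  "s3_elt a0 a1 a2 b0 b1 b2 = s3_elt c0 c1 c2 d0 d1 d2 \<longleftrightarrow>
    a0 = c0 \<and> a1 = c1 \<and> a2 = c2 \<and> b0 = d0 \<and> b1 = d1 \<and> b2 = d2"
  by (metis s3_elt_apply)

text \<open>Indices are exponents of the rotation modulo 3: they add after an \<open>a\<close> and
  subtract after a \<open>b\<close>, since \<open>y * x^j = x^(-j) * y\<close>.\<close>

lemma s3_elt_mult:
  assumes "a0 \<in> carrier R" "a1 \<in> carrier R" "a2 \<in> carrier R"
    "b0 \<in> carrier R" "b1 \<in> carrier R" "b2 \<in> carrier R"
    "c0 \<in> carrier R" "c1 \<in> carrier R" "c2 \<in> carrier R"
    "d0 \<in> carrier R" "d1 \<in> carrier R" "d2 \<in> carrier R"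
  shows "s3_elt a0 a1 a2 b0 b1 b2 \<otimes>\<^bsub>S3alg\<^esub> s3_elt c0 c1 c2 d0 d1 d2 = s3_elt
    (a0 \<otimes> c0 \<oplus> a1 \<otimes> c2 \<oplus> a2 \<otimes> c1 \<oplus> b0 \<otimes> d0 \<oplus> b1 \<otimes> d1 \<oplus> b2 \<otimes> d2)
    (a0 \<otimes> c1 \<oplus> a1 \<otimes> c0 \<oplus> a2 \<otimes> c2 \<oplus> b0 \<otimes> d2 \<oplus> b1 \<otimes> d0 \<oplus> b2 \<otimes> d1)
    (a0 \<otimes> c2 \<oplus> a1 \<otimes> c1 \<oplus> a2 \<otimes> c0 \<oplus> b0 \<otimes> d1 \<oplus> b1 \<otimes> d2 \<oplus> b2 \<otimes> d0)
    (a0 \<otimes> d0 \<oplus> a1 \<otimes> d2 \<oplus> a2 \<otimes> d1 \<oplus> b0 \<otimes> c0 \<oplus> b1 \<otimes> c1 \<oplus> b2 \<otimes> c2)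
    (a0 \<otimes> d1 \<oplus> a1 \<otimes> d0 \<oplus> a2 \<otimes> d2 \<oplus> b0 \<otimes> c2 \<oplus> b1 \<otimes> c0 \<oplus> b2 \<otimes> c1)
    (a0 \<otimes> d2 \<oplus> a1 \<otimes> d1 \<oplus> a2 \<otimes> d0 \<oplus> b0 \<otimes> c1 \<oplus> b1 \<otimes> c2 \<oplus> b2 \<otimes> c0)"
    (is "?f \<otimes>\<^bsub>_\<^esub> ?f' = ?r")
proof (rule group_algebra_eqI[where R = R])
  have inv: "inv\<^bsub>dihedral_group 3\<^esub> (0, s) = (0, s)"
    "inv\<^bsub>dihedral_group 3\<^esub> (1, s) = (if s then 1 else 2, s)"
    "inv\<^bsub>dihedral_group 3\<^esub> (2, s) = (if s then 2 else 1, s)" for s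
    by (simp_all add: inv_dihedral_group carrier_dihedral_group_3)
  have mult: "(i, s) \<otimes>\<^bsub>dihedral_group 3\<^esub> (j, t) =
      ((if s then i - j else i + j) mod 3, s \<noteq> t)" for i j s t
    by (simp add: dihedral_group_def)
  fix g assume g: "g \<in> carrier (dihedral_group 3)"
  then have "(?f \<otimes>\<^bsub>S3alg\<^esub> ?f') g = (\<Oplus>h\<in>{(0, False), (1, False), (2, False),
      (0, True), (1, True), (2, True)}.
      ?f h \<otimes> ?f' (inv\<^bsub>dihedral_group 3\<^esub> h \<otimes>\<^bsub>dihedral_group 3\<^esub> g))"
    by (simp add: group_algebra_apply carrier_dihedral_group_3)
  also have "\<dots> = ?r g"
    using g assms unfolding carrier_dihedral_group_3
    by (elim insertE emptyE) (simp_all add: inv mult a_assoc)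
  finally show "(?f \<otimes>\<^bsub>S3alg\<^esub> ?f') g = ?r g" .
qed (use assms in simp_all)

lemma s3_elt_one: "\<one>\<^bsub>S3alg\<^esub> = s3_elt \<one> \<zero> \<zero> \<zero> \<zero> \<zero>"
proof (rule group_algebra_eqI[where R = R])
  have [simp]: "\<one>\<^bsub>dihedral_group 3\<^esub> = (0, False)" by (simp add: dihedral_group_def)
  fix g assume "g \<in> carrier (dihedral_group 3)"
  moreover from this
  have "\<one>\<^bsub>S3alg\<^esub> g = (if g = (0, False) then \<one> else \<zero>)" by (simp add: group_algebra_apply)
  ultimately show "\<one>\<^bsub>S3alg\<^esub> g = s3_elt \<one> \<zero> \<zero> \<zero> \<zero> \<zero> g"
    by (auto simp: carrier_dihedral_group_3)
qed simp_all

lemma c2_elt_closed [simp]: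
  "a \<in> carrier R \<Longrightarrow> b \<in> carrier R \<Longrightarrow> c2_elt a b \<in> carrier C2alg"
  by (auto simp: carrier_group_algebra c2_elt_def)

lemma c2_elt_cases:
  assumes "f \<in> carrier C2alg"
  obtains a b where "f = c2_elt a b" "a \<in> carrier R" "b \<in> carrier R"
proof
  show c: "f 0 \<in> carrier R" "f 1 \<in> carrier R"
    by (simp_all add: group_algebra_in_carrier[OF assms] carrier_integer_mod_group_2)
  show "f = c2_elt (f 0) (f 1)"
    using assms c by (intro group_algebra_eqI[of f R]) (auto simp: carrier_integer_mod_group_2)
qed

lemma c2_elt_eq_iff: "c2_elt a b = c2_elt c d \<longleftrightarrow> a = c \<and> b = d"
  by (metis c2_elt_apply)

lemma c2_elt_mult:
  assumes "a \<in> carrier R" "b \<in> carrier R" "c \<in> carrier R" "d \<in> carrier R"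
  shows "c2_elt a b \<otimes>\<^bsub>C2alg\<^esub> c2_elt c d = c2_elt (a \<otimes> c \<oplus> b \<otimes> d) (a \<otimes> d \<oplus> b \<otimes> c)"
    (is "?f \<otimes>\<^bsub>_\<^esub> ?f' = ?r")
proof (rule group_algebra_eqI[where R = R])
  have inv: "inv\<^bsub>integer_mod_group 2\<^esub> 0 = 0" "inv\<^bsub>integer_mod_group 2\<^esub> 1 = 1" by simp_all
  fix g assume g: "g \<in> carrier (integer_mod_group 2)"
  then have "(?f \<otimes>\<^bsub>C2alg\<^esub> ?f') g = (\<Oplus>h\<in>{0, 1}.
      ?f h \<otimes> ?f' (inv\<^bsub>integer_mod_group 2\<^esub> h \<otimes>\<^bsub>integer_mod_group 2\<^esub> g))"
    by (simp add: group_algebra_apply carrier_integer_mod_group_2)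
  also have "\<dots> = ?r g"
    using g assms unfolding carrier_integer_mod_group_2
    by (elim insertE emptyE) (simp_all add: inv)
  finally show "(?f \<otimes>\<^bsub>C2alg\<^esub> ?f') g = ?r g" .
qed (use assms in simp_all)

lemma c2_elt_one: "\<one>\<^bsub>C2alg\<^esub> = c2_elt \<one> \<zero>"
proof (rule group_algebra_eqI[where R = R])
  fix g assume "g \<in> carrier (integer_mod_group 2)"
  moreover from this
  have "\<one>\<^bsub>C2alg\<^esub> g = (if g = 0 then \<one> else \<zero>)" by (simp add: group_algebra_apply)
  ultimately show "\<one>\<^bsub>C2alg\<^esub> g = c2_elt \<one> \<zero> g"
    by (auto simp: carrier_integer_mod_group_2)
qed simp_all

section \<open>Projection, section and the units over 1\<close>

text \<open>The algebra map induced by the quotient map from S_3 to C_2, whose fibres are the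
  rotations and the reflections.\<close>

definition proj :: "(int \<times> bool \<Rightarrow> 'a) \<Rightarrow> int \<Rightarrow> 'a"
  where "proj f = c2_elt (f (0, False) \<oplus> f (1, False) \<oplus> f (2, False))
    (f (0, True) \<oplus> f (1, True) \<oplus> f (2, True))"

text \<open>Induced by the embedding of C_2 as the subgroup generated by the reflection y, a
  complement of the rotations.\<close>

definition sect :: "(int \<Rightarrow> 'a) \<Rightarrow> int \<times> bool \<Rightarrow> 'a"
  where "sect f = s3_elt (f 0) \<zero> \<zero> (f 1) \<zero> \<zero>"

lemma proj_hom: "proj \<in> hom S3alg C2alg" "proj \<one>\<^bsub>S3alg\<^esub> = \<one>\<^bsub>C2alg\<^esub>"
proof -
  show "proj \<in> hom S3alg C2alg"
  proof (rule homI)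
    fix f f' assume "f \<in> carrier S3alg" "f' \<in> carrier S3alg"
    then show "proj (f \<otimes>\<^bsub>S3alg\<^esub> f') = proj f \<otimes>\<^bsub>C2alg\<^esub> proj f'"
      by (elim s3_elt_cases)
        (simp add: proj_def s3_elt_mult c2_elt_mult c2_elt_eq_iff l_distr r_distr a_ac m_ac)
  qed (auto elim!: s3_elt_cases simp: proj_def)
qed (simp add: proj_def s3_elt_one c2_elt_one)

lemma sect_hom: "sect \<in> hom C2alg S3alg" "sect \<one>\<^bsub>C2alg\<^esub> = \<one>\<^bsub>S3alg\<^esub>"
proof -
  show "sect \<in> hom C2alg S3alg"
  proof (rule homI)
    fix f f' assume "f \<in> carrier C2alg" "f' \<in> carrier C2alg"
    then show "sect (f \<otimes>\<^bsub>C2alg\<^esub> f') = sect f \<otimes>\<^bsub>S3alg\<^esub> sect f'"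
      by (elim c2_elt_cases) (simp add: sect_def s3_elt_mult c2_elt_mult s3_elt_eq_iff)
  qed (auto elim!: c2_elt_cases simp: sect_def)
qed (simp add: sect_def s3_elt_one c2_elt_one)

lemma proj_sect: "f \<in> carrier C2alg \<Longrightarrow> proj (sect f) = f"
  by (auto elim!: c2_elt_cases simp: proj_def sect_def)

text \<open>
  With \<open>x\<close> the rotation \<open>(1, False)\<close>, \<open>y\<close> the reflection \<open>(0, True)\<close> and \<open>t = x - 1\<close>, so that
  \<open>t^3 = 0\<close> and \<open>y * t = (- t + t^2) * y\<close>, the kernel of \<open>proj\<close> consists of the
  \<open>t * a + t^2 * c + (t * b + t^2 * d) * y\<close>. The coefficient \<open>b\<close> is \<open>refl_coeff\<close>; it is additive
  because two such elements multiply into multiples of \<open>t^2\<close>. Moreover \<open>refl_elt b\<close> is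
  \<open>1 + t * b * y + t^2 * b^2\<close>, where the last term makes it multiplicative, since
  \<open>(t * b * y) * (t * b' * y) = - t^2 * b * b' = t^2 * ((b + b')^2 - b^2 - b'^2)\<close> modulo 3.
  Finally, the \<open>rotation_elt\<close> are the units \<open>1 + t * a + t^2 * c + t^2 * d * y\<close>, parametrized
  by their coordinates at \<open>x\<close>, \<open>x^2\<close> and \<open>y\<close>.
\<close>
definition refl_coeff :: "(int \<times> bool \<Rightarrow> 'a) \<Rightarrow> 'a"
  where "refl_coeff f = f (1, True) \<ominus> f (2, True)"

definition refl_elt :: "'a \<Rightarrow> int \<times> bool \<Rightarrow> 'a"
  where "refl_elt b = s3_elt (\<one> \<oplus> b \<otimes> b) (b \<otimes> b) (b \<otimes> b) (\<ominus> b) b \<zero>"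

definition rotation_elt :: "'a \<Rightarrow> 'a \<Rightarrow> 'a \<Rightarrow> int \<times> bool \<Rightarrow> 'a"
  where "rotation_elt a c d = s3_elt (\<one> \<ominus> a \<ominus> c) a c d d d"

text \<open>Lying over 1 amounts to two linear equations, which determine the coefficients at 1 and
  y from the other four.\<close>

lemma unipotent_cases:
  assumes "f \<in> carrier S3alg" "proj f = \<one>\<^bsub>C2alg\<^esub>"
  obtains a1 a2 b1 b2 where "f = s3_elt (\<one> \<ominus> a1 \<ominus> a2) a1 a2 (\<ominus> b1 \<ominus> b2) b1 b2"
    "a1 \<in> carrier R" "a2 \<in> carrier R" "b1 \<in> carrier R" "b2 \<in> carrier R"
proof -
  obtain a0 a1 a2 b0 b1 b2 where f: "f = s3_elt a0 a1 a2 b0 b1 b2"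
    and c: "a0 \<in> carrier R" "a1 \<in> carrier R" "a2 \<in> carrier R"
      "b0 \<in> carrier R" "b1 \<in> carrier R" "b2 \<in> carrier R"
    using assms(1) by (rule s3_elt_cases)
  have "a0 \<oplus> a1 \<oplus> a2 = \<one>" "b0 \<oplus> b1 \<oplus> b2 = \<zero>"
    using assms(2) by (simp_all add: f proj_def c2_elt_one c2_elt_eq_iff)
  \<comment> \<open>Written so that the sums known to be 1 and 0 occur as subterms that can be
    replaced.\<close>
  moreover have "a0 = a0 \<oplus> a1 \<oplus> a2 \<ominus> a1 \<ominus> a2" "b0 = b0 \<oplus> b1 \<oplus> b2 \<ominus> b1 \<ominus> b2"
    using c by (simp_all add: char3_simps)
  ultimately have "a0 = \<one> \<ominus> a1 \<ominus> a2" "b0 = \<zero> \<ominus> b1 \<ominus> b2" by simp_all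
  then show thesis using that[of a1 a2 b1 b2] f c by (simp add: minus_eq)
qed

lemma refl_coeff_mult:
  assumes "f \<in> carrier S3alg" "proj f = \<one>\<^bsub>C2alg\<^esub>" "f' \<in> carrier S3alg" "proj f' = \<one>\<^bsub>C2alg\<^esub>"
  shows "refl_coeff (f \<otimes>\<^bsub>S3alg\<^esub> f') = refl_coeff f \<oplus> refl_coeff f'"
proof -
  obtain a1 a2 b1 b2 where f: "f = s3_elt (\<one> \<ominus> a1 \<ominus> a2) a1 a2 (\<ominus> b1 \<ominus> b2) b1 b2"
    and c: "a1 \<in> carrier R" "a2 \<in> carrier R" "b1 \<in> carrier R" "b2 \<in> carrier R"
    using assms(1,2) by (rule unipotent_cases)
  obtain a1' a2' b1' b2'
    where f': "f' = s3_elt (\<one> \<ominus> a1' \<ominus> a2') a1' a2' (\<ominus> b1' \<ominus> b2') b1' b2'"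
    and c': "a1' \<in> carrier R" "a2' \<in> carrier R" "b1' \<in> carrier R" "b2' \<in> carrier R"
    using assms(3,4) by (rule unipotent_cases)
  from c c' show ?thesis by (simp add: f f' refl_coeff_def s3_elt_mult char3_simps)
qed

lemma refl_elt_mult:
  assumes "b \<in> carrier R" "b' \<in> carrier R"
  shows "refl_elt b \<otimes>\<^bsub>S3alg\<^esub> refl_elt b' = refl_elt (b \<oplus> b')"
  using assms by (simp add: refl_elt_def s3_elt_mult s3_elt_eq_iff char3_simps)

text \<open>In the t-coordinates above, the product of two differences from 1 reduces to
  \<open>t^2 * a * a'\<close> because \<open>t^3 = 0\<close>, and this is symmetric.\<close>

lemma rotation_elt_commute:
  assumes "a \<in> carrier R" "c \<in> carrier R" "d \<in> carrier R"
    "a' \<in> carrier R" "c' \<in> carrier R" "d' \<in> carrier R"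
  shows "rotation_elt a c d \<otimes>\<^bsub>S3alg\<^esub> rotation_elt a' c' d' =
    rotation_elt a' c' d' \<otimes>\<^bsub>S3alg\<^esub> rotation_elt a c d"
  using assms by (simp add: rotation_elt_def s3_elt_mult s3_elt_eq_iff char3_simps)

text \<open>Modulo 3 the cube of \<open>1 + u\<close> is \<open>1 + u^3\<close>; here
  \<open>u^2 = t^2 * a^2\<close> in the t-coordinates, so \<open>u^3 = 0\<close>.\<close>

lemma rotation_elt_cube:
  assumes "a \<in> carrier R" "c \<in> carrier R" "d \<in> carrier R"
  shows "rotation_elt a c d \<otimes>\<^bsub>S3alg\<^esub> (rotation_elt a c d \<otimes>\<^bsub>S3alg\<^esub> rotation_elt a c d) = \<one>\<^bsub>S3alg\<^esub>"
  using assms by (simp add: rotation_elt_def s3_elt_mult s3_elt_eq_iff s3_elt_one char3_simps)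

section \<open>The unit group of the group algebra of S_3\<close>

text \<open>The splitting criterion is applied twice: to \<open>refl_coeff\<close> on the units over
  1, split by \<open>refl_elt\<close>, and then to \<open>proj\<close> on all units, split by
  \<open>sect\<close>.\<close>

lemma units_S3alg_iso:
  assumes card: "card (carrier R) = 3 ^ m" and "group U" and U: "U \<cong> units_of C2alg"
  shows "\<exists>\<phi> \<psi>. \<phi> \<in> hom (cyclic_power 3 m) (AutoGroup (cyclic_power 3 (3 * m))) \<and>
    \<psi> \<in> hom U
      (AutoGroup (semidirect_product (cyclic_power 3 (3 * m)) (cyclic_power 3 m) \<phi>)) \<and>
    units_of S3alg \<cong> semidirect_product
      (semidirect_product (cyclic_power 3 (3 * m)) (cyclic_power 3 m) \<phi>) U \<psi>"
proof -
  define G where "G = units_of S3alg"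
  define Q where "Q = units_of C2alg"
  define K where "K = kernel G Q proj"
  define P where "P = G\<lparr>carrier := K\<rparr>"
  define N where "N = P\<lparr>carrier := kernel P (add_monoid R) refl_coeff\<rparr>"
  interpret G: group G unfolding G_def by (rule S3alg.units_group)
  interpret Q: group Q unfolding Q_def by (rule C2alg.units_group)
  interpret proj: group_hom G Q proj
    unfolding G_def Q_def
    by (intro group_hom.intro S3alg.units_group C2alg.units_group group_hom_axioms.intro
        hom_units_of proj_hom)
  have sect: "sect \<in> hom Q G"
    unfolding G_def Q_def
    by (intro hom_units_of sect_hom)
  have K: "f \<in> K \<longleftrightarrow> f \<in> Units S3alg \<and> proj f = \<one>\<^bsub>C2alg\<^esub>" for f
    by (simp add: K_def kernel_def G_def Q_def units_of_def)
  have K_in: "f \<in> carrier S3alg" if "f \<in> K" for f using that by (simp add: K S3alg.Units_closed)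
  have P_simps: "carrier P = K" "monoid.mult P = monoid.mult S3alg" "\<one>\<^bsub>P\<^esub> = \<one>\<^bsub>S3alg\<^esub>"
    by (simp_all add: P_def G_def units_of_def)
  interpret P: group P
    unfolding P_def K_def by (rule G.subgroup_imp_group[OF proj.subgroup_kernel])
  have add_grp: "group (add_monoid R)" by (rule add.is_group)
  have refl_coeff_closed: "refl_coeff f \<in> carrier R" if "f \<in> carrier S3alg" for f
    using that by (auto elim!: s3_elt_cases simp: refl_coeff_def)
  have refl_coeff_hom: "refl_coeff \<in> hom P (add_monoid R)"
    by (rule homI) (auto simp: P_simps K_in refl_coeff_closed refl_coeff_mult K)
  interpret rc: group_hom P "add_monoid R" refl_coeff
    by (intro group_hom.intro P.is_group add_grp group_hom_axioms.intro refl_coeff_hom)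
  have refl_elt_closed: "refl_elt b \<in> carrier S3alg" if "b \<in> carrier R" for b
    using that by (simp add: refl_elt_def)
  have refl_elt_K: "refl_elt b \<in> K" if b: "b \<in> carrier R" for b
  proof -
    have zero: "refl_elt \<zero> = \<one>\<^bsub>S3alg\<^esub>" by (simp add: refl_elt_def s3_elt_one)
    \<comment> \<open>As \<open>refl_elt\<close> turns sums into products, the inverse of its value
      at \<open>b\<close> is its value at \<open>\<ominus> b\<close>.\<close>
    have "refl_elt b \<otimes>\<^bsub>S3alg\<^esub> refl_elt (\<ominus> b) = \<one>\<^bsub>S3alg\<^esub>"
      "refl_elt (\<ominus> b) \<otimes>\<^bsub>S3alg\<^esub> refl_elt b = \<one>\<^bsub>S3alg\<^esub>"
      using b by (simp_all add: refl_elt_mult zero r_neg l_neg)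
    then have "refl_elt b \<in> Units S3alg"
      using b refl_elt_closed[of b] refl_elt_closed[of "\<ominus> b"] by (auto simp: Units_def)
    moreover have "proj (refl_elt b) = \<one>\<^bsub>C2alg\<^esub>"
      using b by (simp add: proj_def refl_elt_def c2_elt_one c2_elt_eq_iff char3_simps)
    ultimately show ?thesis by (simp add: K)
  qed
  have refl_elt_hom: "refl_elt \<in> hom (add_monoid R) P"
    by (rule homI) (auto simp: P_simps refl_elt_K refl_elt_mult)
  have refl_coeff_elt: "refl_coeff (refl_elt b) = b" if "b \<in> carrier R" for b
    using that by (simp add: refl_coeff_def refl_elt_def minus_eq)
  define r where "r = (\<lambda>(a, c, d). rotation_elt a c d)"
  have N_carrier: "carrier N = r ` (carrier R \<times> carrier R \<times> carrier R)"
  proof (intro equalityI subsetI)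
    fix f assume "f \<in> carrier N"
    then have f: "f \<in> K" "refl_coeff f = \<zero>" by (auto simp: N_def kernel_def P_simps)
    then obtain a1 a2 b1 b2 where e: "f = s3_elt (\<one> \<ominus> a1 \<ominus> a2) a1 a2 (\<ominus> b1 \<ominus> b2) b1 b2"
      and c: "a1 \<in> carrier R" "a2 \<in> carrier R" "b1 \<in> carrier R" "b2 \<in> carrier R"
      using K_in K by (metis unipotent_cases)
    \<comment> \<open>A vanishing \<open>refl_coeff\<close> forces \<open>b1 = b2\<close>; then
      \<open>\<ominus> b1 \<ominus> b2 = b2\<close> modulo 3, so all three reflection coefficients
      agree.\<close>
    have "b1 \<ominus> b2 = \<zero>" using f(2) by (simp add: e refl_coeff_def)
    then have "b1 = b2" using c by simp
    then have "f = r (a1, a2, b2)"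
      using c by (simp add: e r_def rotation_elt_def s3_elt_eq_iff char3_simps)
    with c show "f \<in> r ` (carrier R \<times> carrier R \<times> carrier R)" by auto
  next
    fix f assume "f \<in> r ` (carrier R \<times> carrier R \<times> carrier R)"
    then obtain a c d where f: "f = rotation_elt a c d"
      and c: "a \<in> carrier R" "c \<in> carrier R" "d \<in> carrier R" by (auto simp: r_def)
    have fc: "f \<in> carrier S3alg" using c by (simp add: f rotation_elt_def)
    \<comment> \<open>The cube of \<open>f\<close> being 1, its square is the inverse.\<close>
    have "f \<otimes>\<^bsub>S3alg\<^esub> (f \<otimes>\<^bsub>S3alg\<^esub> f) = \<one>\<^bsub>S3alg\<^esub>"
      unfolding f using c by (rule rotation_elt_cube)
    then have "f \<in> Units S3alg"
      using fc by (auto simp: Units_def S3alg.m_assoc intro!: bexI[of _ "f \<otimes>\<^bsub>S3alg\<^esub> f"])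
    moreover have "proj f = \<one>\<^bsub>C2alg\<^esub>"
      using c by (simp add: f proj_def rotation_elt_def c2_elt_one c2_elt_eq_iff char3_simps)
    moreover have "refl_coeff f = \<zero>"
      using c by (simp add: f refl_coeff_def rotation_elt_def char3_simps)
    ultimately show "f \<in> carrier N" by (simp add: N_def kernel_def P_simps K)
  qed
  have "inj_on r (carrier R \<times> carrier R \<times> carrier R)"
    by (auto simp: inj_on_def r_def rotation_elt_def s3_elt_eq_iff)
  \<comment> \<open>Three free coordinates in a ring of order \<open>3 ^ m\<close> give the exponent
    \<open>3 * m\<close>.\<close>
  then have N_card: "card (carrier N) = 3 ^ (3 * m)"
    by (simp add: N_carrier card_image card_cartesian_product card power_mult power3_eq_cube
        power_mult_distrib mult.commute[of 3])
  interpret N: group N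
    unfolding N_def by (rule P.subgroup_imp_group[OF rc.subgroup_kernel])
  have N_mult: "monoid.mult N = monoid.mult S3alg" "\<one>\<^bsub>N\<^esub> = \<one>\<^bsub>S3alg\<^esub>"
    by (simp_all add: N_def P_simps)
  have N_iso: "cyclic_power 3 (3 * m) \<cong> N"
  proof (rule elementary_abelian_iso_cyclic_power)
    show "comm_group N"
      by (rule N.group_comm_groupI) (auto simp: N_carrier N_mult r_def rotation_elt_commute)
    show "x [^]\<^bsub>N\<^esub> (3::nat) = \<one>\<^bsub>N\<^esub>" if "x \<in> carrier N" for x
    proof -
      have "x \<otimes>\<^bsub>N\<^esub> (x \<otimes>\<^bsub>N\<^esub> x) = \<one>\<^bsub>N\<^esub>"
        using that by (auto simp: N_carrier N_mult r_def rotation_elt_cube)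
      then show ?thesis using that by (simp add: numeral_3_eq_3 N.m_assoc)
    qed
  qed (simp_all add: N_card)
  have R_iso: "cyclic_power 3 m \<cong> add_monoid R"
  proof (rule elementary_abelian_iso_cyclic_power)
    show "x [^]\<^bsub>add_monoid R\<^esub> (3::nat) = \<one>\<^bsub>add_monoid R\<^esub>" if "x \<in> carrier (add_monoid R)" for x
      using that char3[of x] by (simp add: numeral_3_eq_3 a_assoc)
  qed (simp_all add: card a_comm_group)
  obtain \<phi> where \<phi>: "\<phi> \<in> hom (cyclic_power 3 m) (AutoGroup (cyclic_power 3 (3 * m)))"
    and P_iso: "P \<cong> semidirect_product (cyclic_power 3 (3 * m)) (cyclic_power 3 m) \<phi>"
    using split_extension_iso_semidirect_product[OF P.is_group _ _ add_grp refl_coeff_hom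
        refl_elt_hom _ N_iso[unfolded N_def] R_iso] refl_coeff_elt
    by auto
  have sd: "group (semidirect_product (cyclic_power 3 (3 * m)) (cyclic_power 3 m) \<phi>)"
    by (intro semidirect_product_is_group \<phi>) simp_all
  have "\<exists>\<psi>\<in>hom U (AutoGroup (semidirect_product (cyclic_power 3 (3 * m)) (cyclic_power 3 m) \<phi>)).
    G \<cong> semidirect_product (semidirect_product (cyclic_power 3 (3 * m)) (cyclic_power 3 m) \<phi>) U \<psi>"
  proof (rule split_extension_iso_semidirect_product[OF G.is_group sd \<open>group U\<close> Q.is_group
        proj.homh sect])
    show "proj (sect x) = x" if "x \<in> carrier Q" for x
      using that by (intro proj_sect) (auto simp: Q_def units_of_def Units_def)
    show "semidirect_product (cyclic_power 3 (3 * m)) (cyclic_power 3 m) \<phi>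
        \<cong> G\<lparr>carrier := kernel G Q proj\<rparr>"
      using P.iso_sym[OF P_iso] by (simp add: P_def K_def)
  qed (simp add: U Q_def)
  with \<phi> show ?thesis unfolding G_def by blast
qed

end

section \<open>Decomposition of the dihedral group of order 12 and of C_2^2\<close>

text \<open>By the Chinese remainder theorem \<open>3 * i + 4 * j\<close> is \<open>i\<close> modulo 2 and \<open>j\<close> modulo 3.\<close>
lemma iso_Z2_S3_dihedral_group_6:
  "(\<lambda>((c, i), (j, s)). (c, ((3 * i + 4 * j) mod 6, s)))
    \<in> iso ((Z \<times>\<times> integer_mod_group 2) \<times>\<times> dihedral_group 3) (Z \<times>\<times> dihedral_group 6)"
    (is "?h \<in> _")
proof -
  have D6: "carrier (dihedral_group 6) = {0, 1, 2, 3, 4, 5} \<times> UNIV"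
  proof -
    have "{0..<6::int} = {0, 1, 2, 3, 4, 5}" by auto
    then show ?thesis by (simp add: dihedral_group_def)
  qed
  have mult: "(i, s) \<otimes>\<^bsub>dihedral_group m\<^esub> (j, t) =
      ((if s then i - j else i + j) mod int m, s \<noteq> t)" for i j s t m
    by (simp add: dihedral_group_def)
  \<comment> \<open>Since 3 is its own negative modulo 6, a reflection fixes the C_2 part and
    inverts the part of order 3; the rest is a finite check.\<close>
  have "?h \<in> hom ((Z \<times>\<times> integer_mod_group 2) \<times>\<times> dihedral_group 3) (Z \<times>\<times> dihedral_group 6)"
    by (rule homI)
      (auto simp: carrier_integer_mod_group_2 carrier_dihedral_group_3 D6 mult)
  moreover have "bij_betw ?h ((carrier Z \<times> carrier (integer_mod_group 2)) \<times> carrier (dihedral_group 3))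
      (carrier Z \<times> carrier (dihedral_group 6))"
    by (rule bij_betwI[where g = "\<lambda>(c, (l, s)). ((c, l mod 2), (l mod 3, s))"])
      (auto simp: carrier_integer_mod_group_2 carrier_dihedral_group_3 D6)
  ultimately show ?thesis by (simp add: iso_def)
qed

text \<open>Brings out the same factor \<open>Z \<times>\<times> integer_mod_group 2\<close> as the
  decomposition of the dihedral group, so that both group algebras can be curried over one
  coefficient ring.\<close>

lemma iso_Z2_Z2_cyclic_power_2_2:
  "(\<lambda>((c, i), j). (c, \<lambda>t\<in>{..<2}. if t = 0 then i else j))
    \<in> iso ((Z \<times>\<times> integer_mod_group 2) \<times>\<times> integer_mod_group 2) (Z \<times>\<times> cyclic_power 2 2)"
    (is "?h \<in> _")
proof -
  have apply_in: "v t \<in> carrier (integer_mod_group 2)"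
    if "v \<in> carrier (cyclic_power 2 2)" "t < 2" for v t
    using that PiE_mem[of v "{..<2}" "\<lambda>_. carrier (integer_mod_group 2)" t]
    by (simp add: cyclic_power_def)
  have "?h \<in> hom ((Z \<times>\<times> integer_mod_group 2) \<times>\<times> integer_mod_group 2) (Z \<times>\<times> cyclic_power 2 2)"
    by (rule homI) (auto simp: cyclic_power_def fun_eq_iff)
  moreover have "bij_betw ?h ((carrier Z \<times> carrier (integer_mod_group 2)) \<times> carrier (integer_mod_group 2))
      (carrier Z \<times> carrier (cyclic_power 2 2))"
  proof (rule bij_betwI[where g = "\<lambda>(c, v). ((c, v 0), v 1)"])
    fix p assume p: "p \<in> carrier Z \<times> carrier (cyclic_power 2 2)"
    obtain c v where cv: "p = (c, v)" by force
    have v: "v \<in> {..<2} \<rightarrow>\<^sub>E carrier (integer_mod_group 2)"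
      using p by (simp add: cv cyclic_power_def)
    \<comment> \<open>Outside \<open>{..<2}\<close> both sides are \<open>undefined\<close>, by
      extensionality of \<open>v\<close>.\<close>
    have "(\<lambda>t\<in>{..<2}. if t = 0 then v 0 else v 1) = v"
    proof
      fix t :: nat
      consider "t = 0" | "t = 1" | "t \<notin> {..<2}" by fastforce
      then show "(\<lambda>t\<in>{..<2}. if t = 0 then v 0 else v 1) t = v t"
        by cases (use PiE_arb[OF v] in auto)
    qed
    then show "?h ((\<lambda>(c, v). ((c, v 0), v 1)) p) = p"
      unfolding cv prod.case by simp
  next
    show "?h \<in> (carrier Z \<times> carrier (integer_mod_group 2)) \<times> carrier (integer_mod_group 2)
        \<rightarrow> carrier Z \<times> carrier (cyclic_power 2 2)"
      by (auto simp: cyclic_power_def)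
    show "(\<lambda>(c, v). ((c, v 0), v 1)) \<in> carrier Z \<times> carrier (cyclic_power 2 2)
        \<rightarrow> (carrier Z \<times> carrier (integer_mod_group 2)) \<times> carrier (integer_mod_group 2)"
      by (rule funcsetI) (auto simp: apply_in)
  qed auto
  ultimately show ?thesis by (simp add: iso_def)
qed

theorem theorem3p2:
  fixes F :: "('f, 'm) ring_scheme" and n k :: nat
  assumes "field F" and "finite (carrier F)" and "ring_char F = 3"
    and "card (carrier F) = 3 ^ k" and "n \<ge> 1"
  shows "\<exists>\<phi> \<psi>.
    \<phi> \<in> hom (cyclic_power 3 (2 * n * k)) (AutoGroup (cyclic_power 3 (6 * n * k))) \<and>
    \<psi> \<in> hom (units_of (group_algebra F (integer_mod_group n \<times>\<times> cyclic_power 2 2)))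
      (AutoGroup (semidirect_product (cyclic_power 3 (6 * n * k)) (cyclic_power 3 (2 * n * k)) \<phi>)) \<and>
    units_of (group_algebra F (integer_mod_group n \<times>\<times> dihedral_group 6)) \<cong>
      semidirect_product
        (semidirect_product (cyclic_power 3 (6 * n * k)) (cyclic_power 3 (2 * n * k)) \<phi>)
        (units_of (group_algebra F (integer_mod_group n \<times>\<times> cyclic_power 2 2))) \<psi>"
proof -
  interpret F: field F by fact
  let ?Z = "integer_mod_group n \<times>\<times> integer_mod_group 2"
  let ?D = "integer_mod_group n \<times>\<times> dihedral_group 6"
  let ?H = "integer_mod_group n \<times>\<times> cyclic_power 2 2"
  let ?R = "group_algebra F ?Z"
  have Z: "comm_group ?Z"
  proof (rule group.group_comm_groupI)
    show "group ?Z" by (simp add: DirProd_group)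
  qed (auto simp: add.commute)
  \<comment> \<open>\<open>n \<ge> 1\<close> excludes \<open>integer_mod_group 0\<close>, which is
    the infinite cyclic group.\<close>
  have Zc: "carrier ?Z = {0..<int n} \<times> {0, 1}"
    unfolding carrier_DirProd carrier_integer_mod_group_2
    using \<open>n \<ge> 1\<close> by (simp add: carrier_integer_mod_group)
  interpret R: cring ?R
    by (rule group_algebra_is_cring[OF F.cring_axioms Z]) (simp add: Zc del: carrier_DirProd)
  interpret R: cring_char3 ?R
  proof
    \<comment> \<open>The characteristic is the additive order of 1, so three times 1 vanishes; this
      passes to every \<open>y\<close> by distributivity and to functions coefficientwise.\<close>
    have "\<one>\<^bsub>F\<^esub> [^]\<^bsub>add_monoid F\<^esub> (3::nat) = \<zero>\<^bsub>F\<^esub>"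
      using group.pow_ord_eq_1[OF F.add.is_group, of "\<one>\<^bsub>F\<^esub>"] assms(3) by (simp add: ring_char_def)
    then have one: "\<one>\<^bsub>F\<^esub> \<oplus>\<^bsub>F\<^esub> (\<one>\<^bsub>F\<^esub> \<oplus>\<^bsub>F\<^esub> \<one>\<^bsub>F\<^esub>) = \<zero>\<^bsub>F\<^esub>"
      by (simp add: numeral_3_eq_3 F.a_assoc)
    have "y \<oplus>\<^bsub>F\<^esub> (y \<oplus>\<^bsub>F\<^esub> y) = \<zero>\<^bsub>F\<^esub>" if "y \<in> carrier F" for y
    proof -
      have "y \<oplus>\<^bsub>F\<^esub> (y \<oplus>\<^bsub>F\<^esub> y) = y \<otimes>\<^bsub>F\<^esub> (\<one>\<^bsub>F\<^esub> \<oplus>\<^bsub>F\<^esub> (\<one>\<^bsub>F\<^esub> \<oplus>\<^bsub>F\<^esub> \<one>\<^bsub>F\<^esub>))"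
        using that by (simp add: F.r_distr)
      with that show ?thesis by (simp add: one)
    qed
    then show "x \<oplus>\<^bsub>?R\<^esub> (x \<oplus>\<^bsub>?R\<^esub> x) = \<zero>\<^bsub>?R\<^esub>" if "x \<in> carrier ?R" for x
      using that by (intro group_algebra_eqI[of _ F ?Z])
        (auto simp: group_algebra_apply group_algebra_in_carrier simp del: carrier_DirProd)
  qed
  \<comment> \<open>\<open>?Z\<close> has \<open>2 * n\<close> elements and each coefficient takes
    \<open>3 ^ k\<close> values, hence \<open>m = 2 * n * k\<close> in
    \<open>units_S3alg_iso\<close>.\<close>
  have card: "card (carrier ?R) = 3 ^ (2 * n * k)"
    by (subst card_group_algebra)
      (simp_all add: Zc assms(4) card_cartesian_product power_mult[symmetric] mult.commute mult.left_commute del: carrier_DirProd)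
  have D: "group ?D" and H: "group ?H"
    by (simp_all add: DirProd_group dihedral_group_is_group)
  \<comment> \<open>Finiteness makes \<open>group_algebra F ?H\<close> a ring, so that its units,
    the acting factor, form a group.\<close>
  have "finite (carrier ?H)"
    using \<open>n \<ge> 1\<close> by (simp add: carrier_integer_mod_group cyclic_power_def finite_PiE)
  then interpret FH: ring "group_algebra F ?H"
    using F.ring_axioms H by (intro group_algebra_is_ring)
  have D3: "group (dihedral_group 3)" by (rule dihedral_group_is_group) simp
  have Zg: "group ?Z" and finZ: "finite (carrier ?Z)"
    and fin2: "finite (carrier (integer_mod_group 2))" and fin3: "finite (carrier (dihedral_group 3))"
    using Z by (simp_all add: comm_group_def Zc carrier_integer_mod_group_2 carrier_dihedral_group_3
        del: carrier_DirProd)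
  \<comment> \<open>Both algebras become group algebras over the same ring \<open>?R\<close>: that
    of S_3 for \<open>?D\<close>, that of C_2 for \<open>?H\<close>.\<close>
  have FD_iso: "units_of (group_algebra F ?D) \<cong> units_of R.S3alg"
    by (rule units_of_group_algebra_curry[OF F.ring_axioms Zg D3 D finZ fin3
        iso_Z2_S3_dihedral_group_6])
  have FH_iso: "units_of (group_algebra F ?H) \<cong> units_of R.C2alg"
    by (rule units_of_group_algebra_curry[OF F.ring_axioms Zg group_integer_mod_group H finZ fin2
        iso_Z2_Z2_cyclic_power_2_2])
  have "6 * n * k = 3 * (2 * n * k)" by simp
  then show ?thesis
    using R.units_S3alg_iso[OF card FH.units_group FH_iso] iso_trans[OF FD_iso] by metis
qed

end
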